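(* Suppose that $AT>1$ and $\rho>\xi(1-\sigma)$. Let $\Phi:\mathcal O\to\mathbb R$ be the feedback map $$\Phi(x)=Ax^0-\nu^{-1/\sigma}\left(\frac A\xi\right)^{1/\sigma}\Gamma_0(x),\qquad \nu=\left(\frac{\rho-\xi(1-\sigma)}{\sigma}\right)^{-\sigma}\left(\frac A\xi\right)^{1-\sigma}.$$ Let $x\in\mathcal O$ be an initial state with $x^0>0$ and $x^1\le0$ a.e. If the unique solution $y(\cdot)$ of the closed-loop system $$y'(t)=\mathcal A^*y(t)+B^*\Phi(y(t)),\qquad y(0)=x,$$ remains in $\mathcal O$ for all $t\ge0$, then the control $u^*(t)=\Phi(y(t))$ is optimal for the infinite-dimensional problem starting at $x$, and the value function satisfies $$V(x)=v(x):=\nu\,\frac{[\Gamma_0(x)]^{1-\sigma}}{1-\sigma}.$$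
   Context: $A>0$, $T>0$, $\rho>0$, $\sigma>0$ with $\sigma\ne1$ are real constants. When $AT>1$, $\xi$ denotes the unique strictly positive root of $z=A(1-e^{-zT})$. $X=\mathbb R\times L^2(-T,0;\mathbb R)$ with elements $x=(x^0,x^1)$ and inner product $\langle x,z\rangle=x^0z^0+\langle x^1,z^1\rangle_{L^2}$. $D(\mathcal A)=\{(\psi^0,\psi^1)\in X:\psi^1\in W^{1,2}(-T,0;\mathbb R),\ \psi^0=\psi^1(0)\}$, $\mathcal A(\psi^0,\psi^1)=(0,\frac{d}{ds}\psi^1)$; $B:D(\mathcal A)\to\mathbb R$, $B(\psi^0,\psi^1)=\psi^1(0)-\psi^1(-T)$. Their adjoints are viewed as $\mathcal A^*:X\to D(\mathcal A)'$ and $B^*:\mathbb R\to D(\mathcal A)'$. $\Gamma_0(x)=x^0+\int_{-T}^0e^{\xi s}x^1(s)\,ds$ and $$\mathcal O=\left\{x\in X:\ \Gamma_0(x)>0\ \text{ and }\ Ax^0>\nu^{-1/\sigma}\left(\tfrac A\xi\right)^{1/\sigma}\Gamma_0(x)\right\}.$$ Infinite-dimensional problem. For $x\in X$ and $i(\cdot)\in L^2_{\rm loc}([0,\infty);\mathbb R^+)$, $y^{x,i}(\cdot)=(y^0,y^1)(\cdot)$ is the unique solution of $y'(t)=\mathcal A^*y(t)+B^*i(t)$, $y(0)=x$, in the class of functions which, for every $\tau>0$, belong to $C([0,\tau];X)$ with derivative in $L^2(0,\tau;D(\mathcal A)')$; solutions of the closed-loop system are understood in the same class. (If $x=(k_0,F(\bar\iota))$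 with $F(z)(s)=-z(-T-s)$, then $y^0(t)=k_0-\int_{-T}^{(t-T)\wedge0}\bar\iota(s)\,ds+\int_0^ti(s)\,ds-\int_0^{(t-T)\vee0}i(s)\,ds$ and $y^1(t)=F(i(t+\cdot)|_{[-T,0]})$, with $i=\bar\iota$ on $[-T,0)$.) Admissible controls from $x$: those $i(\cdot)\in L^2_{\rm loc}([0,\infty);\mathbb R^+)$ with $i(t)\in[0,Ay^0(t)]$ for all $t\ge 0$ (a.e.). Objective to be maximized: $\int_0^\infty e^{-\rho t}\frac{(Ay^0(t)-i(t))^{1-\sigma}}{1-\sigma}\,dt$ (possibly $-\infty$ when $\sigma>1$); $V(x)$ is its supremum over admissible controls, and a control is optimal if it is admissible and attains $V(x)$. *)

theory Defs
  imports "HOL-Analysis.Analysis"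
begin

section \<open>Square-integrable functions and weak derivatives on an interval\<close>

text \<open>Elements of L2(a,b) are handled through Lebesgue measurable representatives on [a,b]; only
  their values almost everywhere on [a,b] matter.\<close>

definition L2 :: "real \<Rightarrow> real \<Rightarrow> (real \<Rightarrow> real) \<Rightarrow> bool" where
  "L2 a b f \<longleftrightarrow> f \<in> borel_measurable (lebesgue_on {a..b}) \<and>
     integrable (lebesgue_on {a..b}) (\<lambda>s. (f s)\<^sup>2)"

definition test_function :: "real \<Rightarrow> real \<Rightarrow> (real \<Rightarrow> real) \<Rightarrow> bool" where
  "test_function a b \<phi> \<longleftrightarrow> \<phi> C1_differentiable_on UNIV \<and>
     (\<exists>c d. a < c \<and> c \<le> d \<and> d < b \<and> (\<forall>s. s \<notin> {c..d} \<longrightarrow> \<phi> s = 0))"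

definition weak_deriv :: "real \<Rightarrow> real \<Rightarrow> (real \<Rightarrow> real) \<Rightarrow> (real \<Rightarrow> real) \<Rightarrow> bool" where
  "weak_deriv a b f g \<longleftrightarrow> (\<forall>\<phi>. test_function a b \<phi> \<longrightarrow>
     (LINT s|lebesgue_on {a..b}. f s * deriv \<phi> s) = - (LINT s|lebesgue_on {a..b}. g s * \<phi> s))"

definition W12 :: "real \<Rightarrow> real \<Rightarrow> (real \<Rightarrow> real) \<Rightarrow> bool" where
  "W12 a b f \<longleftrightarrow> L2 a b f \<and> (\<exists>g. L2 a b g \<and> weak_deriv a b f g)"

section \<open>The state space\<close>

type_synonym state = "real \<times> (real \<Rightarrow> real)"

definition X_space :: "real \<Rightarrow> state set" where
  "X_space T = {x. L2 (- T) 0 (snd x)}"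

definition X_inner :: "real \<Rightarrow> state \<Rightarrow> state \<Rightarrow> real" where
  "X_inner T x z = fst x * fst z + (LINT s|lebesgue_on {- T..0}. snd x s * snd z s)"

definition X_norm :: "real \<Rightarrow> state \<Rightarrow> real" where
  "X_norm T x = sqrt (X_inner T x x)"

definition X_comb :: "real \<Rightarrow> state \<Rightarrow> real \<Rightarrow> state \<Rightarrow> state" where
  "X_comb a x b z = (a * fst x + b * fst z, \<lambda>s. a * snd x s + b * snd z s)"

definition X_eq :: "real \<Rightarrow> state \<Rightarrow> state \<Rightarrow> bool" where
  "X_eq T x z \<longleftrightarrow> fst x = fst z \<and> (AE s in lebesgue_on {- T..0}. snd x s = snd z s)"

definition X_continuous_on :: "real \<Rightarrow> real set \<Rightarrow> (real \<Rightarrow> state) \<Rightarrow> bool" where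
  "X_continuous_on T S y \<longleftrightarrow> (\<forall>t\<in>S. y t \<in> X_space T) \<and>
     (\<forall>t\<in>S. ((\<lambda>s. X_norm T (X_comb 1 (y s) (- 1) (y t))) \<longlongrightarrow> 0) (at t within S))"

section \<open>The operators, the dual of the domain, and the adjoints\<close>

text \<open>A class in W12 is represented in the domain by its continuous representative on [-T,0], so
  that the point values at 0 and -T are meaningful.\<close>

definition domA :: "real \<Rightarrow> state set" where
  "domA T = {\<psi>. W12 (- T) 0 (snd \<psi>) \<and> continuous_on {- T..0} (snd \<psi>) \<and> fst \<psi> = snd \<psi> 0}"

text \<open>The choice only selects a representative: weak derivatives are unique almost everywhere.\<close>

definition opA :: "real \<Rightarrow> state \<Rightarrow> state" where
  "opA T \<psi> = (0, SOME g. L2 (- T) 0 g \<and> weak_deriv (- T) 0 (snd \<psi>) g)"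

definition opB :: "real \<Rightarrow> state \<Rightarrow> real" where
  "opB T \<psi> = snd \<psi> 0 - snd \<psi> (- T)"

definition graph_norm :: "real \<Rightarrow> state \<Rightarrow> real" where
  "graph_norm T \<psi> = sqrt ((X_norm T \<psi>)\<^sup>2 + (X_norm T (opA T \<psi>))\<^sup>2)"

text \<open>Elements of D(A)' are the bounded linear functionals on D(A) with the graph norm; their
  values outside D(A) are irrelevant. An element z of X is identified with the functional
  taking psi to the X-inner product of z and psi.\<close>

definition in_dual :: "real \<Rightarrow> (state \<Rightarrow> real) \<Rightarrow> bool" where
  "in_dual T l \<longleftrightarrow>
     (\<forall>\<psi>\<in>domA T. \<forall>\<phi>\<in>domA T. \<forall>a b. l (X_comb a \<psi> b \<phi>) = a * l \<psi> + b * l \<phi>) \<and>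
     (\<exists>C. \<forall>\<psi>\<in>domA T. \<bar>l \<psi>\<bar> \<le> C * graph_norm T \<psi>)"

definition dual_norm :: "real \<Rightarrow> (state \<Rightarrow> real) \<Rightarrow> real" where
  "dual_norm T l = Sup {\<bar>l \<psi>\<bar> | \<psi>. \<psi> \<in> domA T \<and> graph_norm T \<psi> \<le> 1}"

definition adjA :: "real \<Rightarrow> state \<Rightarrow> (state \<Rightarrow> real)" where
  "adjA T x = (\<lambda>\<psi>. X_inner T x (opA T \<psi>))"

definition adjB :: "real \<Rightarrow> real \<Rightarrow> (state \<Rightarrow> real)" where
  "adjB T r = (\<lambda>\<psi>. r * opB T \<psi>)"

text \<open>The space L2(0,tau; D(A)'). Since D(A) is a separable Hilbert space, so is D(A)', and by
  Pettis' theorem strong measurability is measurability of all the evaluations.\<close>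

definition L2_dual :: "real \<Rightarrow> real \<Rightarrow> (real \<Rightarrow> state \<Rightarrow> real) \<Rightarrow> bool" where
  "L2_dual T \<tau> d \<longleftrightarrow>
     (AE t in lebesgue_on {0..\<tau>}. in_dual T (d t)) \<and>
     (\<forall>\<psi>\<in>domA T. (\<lambda>t. d t \<psi>) \<in> borel_measurable (lebesgue_on {0..\<tau>})) \<and>
     L2 0 \<tau> (\<lambda>t. dual_norm T (d t))"

text \<open>The distributional derivative in D(A)': an identity between D(A)'-valued integrals of the
  curves against scalar test functions, which may be evaluated at every psi in D(A).\<close>

definition dual_deriv :: "real \<Rightarrow> real \<Rightarrow> (real \<Rightarrow> state) \<Rightarrow> (real \<Rightarrow> state \<Rightarrow> real) \<Rightarrow> bool" where
  "dual_deriv T \<tau> y d \<longleftrightarrow>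
     (\<forall>\<psi>\<in>domA T. weak_deriv 0 \<tau> (\<lambda>t. X_inner T (y t) \<psi>) (\<lambda>t. d t \<psi>))"

section \<open>The state equation\<close>

text \<open>y solves y' = A* y + B* i, y(0) = x. The equation is an equality of elements of D(A)' at almost
  every time. No sign is imposed on i here, so that the closed-loop system is the instance
  in which i is the feedback along y.\<close>

definition state_solution :: "real \<Rightarrow> state \<Rightarrow> (real \<Rightarrow> real) \<Rightarrow> (real \<Rightarrow> state) \<Rightarrow> bool" where
  "state_solution T x i y \<longleftrightarrow> X_eq T (y 0) x \<and>
     (\<forall>\<tau>>0. X_continuous_on T {0..\<tau>} y \<and>
        (\<exists>d. L2_dual T \<tau> d \<and> dual_deriv T \<tau> y d \<and>
           (AE t in lebesgue_on {0..\<tau>}. \<forall>\<psi>\<in>domA T. d t \<psi> = adjA T (y t) \<psi> + adjB T (i t) \<psi>)))"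

section \<open>The optimal control problem\<close>

text \<open>Since 0 powr a = 0 in Isabelle, the value at zero consumption for sigma > 1 has to be set
  to minus infinity explicitly.\<close>

definition utility :: "real \<Rightarrow> real \<Rightarrow> ereal" where
  "utility \<sigma> c = (if c > 0 then ereal (c powr (1 - \<sigma>) / (1 - \<sigma>))
                   else if c = 0 \<and> \<sigma> < 1 then 0 else - \<infinity>)"

text \<open>Difference of the integrals of positive and negative part; the objective below has an
  integrand of constant sign on admissible pairs.\<close>

definition ereal_integral :: "'a measure \<Rightarrow> ('a \<Rightarrow> ereal) \<Rightarrow> ereal" where
  "ereal_integral M f = enn2ereal (\<integral>\<^sup>+ t. e2ennreal (f t) \<partial>M) - enn2ereal (\<integral>\<^sup>+ t. e2ennreal (- f t) \<partial>M)"

definition objective ::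
    "real \<Rightarrow> real \<Rightarrow> real \<Rightarrow> (real \<Rightarrow> real) \<Rightarrow> (real \<Rightarrow> state) \<Rightarrow> ereal" where
  "objective A \<rho> \<sigma> i y = ereal_integral (lebesgue_on {0..})
     (\<lambda>t. ereal (exp (- \<rho> * t)) * utility \<sigma> (A * fst (y t) - i t))"

definition admissible_pair ::
    "real \<Rightarrow> real \<Rightarrow> state \<Rightarrow> (real \<Rightarrow> real) \<Rightarrow> (real \<Rightarrow> state) \<Rightarrow> bool" where
  "admissible_pair A T x i y \<longleftrightarrow> (\<forall>\<tau>>0. L2 0 \<tau> i) \<and> state_solution T x i y \<and>
     (AE t in lebesgue_on {0..}. 0 \<le> i t \<and> i t \<le> A * fst (y t))"

definition value_function :: "real \<Rightarrow> real \<Rightarrow> real \<Rightarrow> real \<Rightarrow> state \<Rightarrow> ereal" where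
  "value_function A T \<rho> \<sigma> x = Sup {objective A \<rho> \<sigma> i y | i y. admissible_pair A T x i y}"

definition optimal_control ::
    "real \<Rightarrow> real \<Rightarrow> real \<Rightarrow> real \<Rightarrow> state \<Rightarrow> (real \<Rightarrow> real) \<Rightarrow> bool" where
  "optimal_control A T \<rho> \<sigma> x i \<longleftrightarrow>
     (\<exists>y. admissible_pair A T x i y \<and> objective A \<rho> \<sigma> i y = value_function A T \<rho> \<sigma> x)"

section \<open>The explicit value function and feedback\<close>

definition xi :: "real \<Rightarrow> real \<Rightarrow> real" where
  "xi A T = (THE z. z > 0 \<and> z = A * (1 - exp (- z * T)))"

definition Gamma0 :: "real \<Rightarrow> real \<Rightarrow> state \<Rightarrow> real" where
  "Gamma0 A T x = fst x + (LINT s|lebesgue_on {- T..0}. exp (xi A T * s) * snd x s)"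

definition nu :: "real \<Rightarrow> real \<Rightarrow> real \<Rightarrow> real \<Rightarrow> real" where
  "nu A T \<rho> \<sigma> = ((\<rho> - xi A T * (1 - \<sigma>)) / \<sigma>) powr (- \<sigma>) * (A / xi A T) powr (1 - \<sigma>)"

definition feedback :: "real \<Rightarrow> real \<Rightarrow> real \<Rightarrow> real \<Rightarrow> state \<Rightarrow> real" where
  "feedback A T \<rho> \<sigma> x = A * fst x
     - nu A T \<rho> \<sigma> powr (- 1 / \<sigma>) * (A / xi A T) powr (1 / \<sigma>) * Gamma0 A T x"

definition O_region :: "real \<Rightarrow> real \<Rightarrow> real \<Rightarrow> real \<Rightarrow> state set" where
  "O_region A T \<rho> \<sigma> = {x \<in> X_space T. Gamma0 A T x > 0 \<and>
     A * fst x > nu A T \<rho> \<sigma> powr (- 1 / \<sigma>) * (A / xi A T) powr (1 / \<sigma>) * Gamma0 A T x}"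

definition v_explicit :: "real \<Rightarrow> real \<Rightarrow> real \<Rightarrow> real \<Rightarrow> state \<Rightarrow> real" where
  "v_explicit A T \<rho> \<sigma> x = nu A T \<rho> \<sigma> * (Gamma0 A T x powr (1 - \<sigma>) / (1 - \<sigma>))"

end

theory Submission
  imports Defs
begin

text \<open>
  Write \<open>r\<close> for \<open>xi A T\<close>. Pairing the state equation with \<open>(1, exp (r s))\<close> and using
  \<open>r = A (1 - exp (- r T))\<close>, the number \<open>G t\<close>, i.e. \<open>Gamma0\<close> along a trajectory, satisfies
  \<open>G' = r G - (r / A) c\<close> with the consumption \<open>c = A y\<^sup>0 - i \<ge> 0\<close>, whatever the control. Hence
  \<open>\<integral>\<^sub>0\<^sup>t exp (- r s) c(s) ds = (A / r) (G 0 - exp (- r t) G t)\<close>, and once \<open>G \<ge> 0\<close> is known every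
  admissible control obeys the budget constraint \<open>\<integral>\<^sub>0\<^sup>\<infinity> exp (- r s) c(s) ds \<le> (A / r) G 0\<close>.
  The feedback consumes a fixed multiple of \<open>G\<close>, so its consumption \<open>k\<close> is an exponential; it
  exhausts the budget, and its discounted marginal utility is a multiple of \<open>exp (- r t)\<close>. The
  tangent-line inequality for the concave utility at \<open>k\<close>, integrated against the budget
  constraint, gives optimality.

  Nonnegativity of \<open>G\<close>: the transport equation with boundary data \<open>- i \<le> 0\<close> and initial data
  \<open>x\<^sup>1 \<le> 0\<close> keeps \<open>y\<^sup>1\<close> nonpositive, so \<open>G\<close> dominates \<open>y\<^sup>0 + \<integral> y\<^sup>1\<close>, which is constant in time. But
  \<open>exp (- r t) G t\<close> is nonincreasing, so a negative value of \<open>G\<close> would force \<open>G \<longrightarrow> - \<infinity>\<close>.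
\<close>

section \<open>Weak derivatives on an interval\<close>

text \<open>The positive and negative parts of the function are densities of two finite measures
  that agree on every half-line \<open>{x<..}\<close>. Half-lines determine a finite Borel measure,
  and a finite measure determines its density almost everywhere.\<close>

lemma AE_eq_0_of_half_line_integrals:
  fixes h :: "real \<Rightarrow> real"
  assumes int: "integrable lebesgue h"
    and zero: "\<And>x. (LINT s|lebesgue. indicator {x<..} s * h s) = 0"
  shows "AE s in lebesgue. h s = 0"
proof -
  \<comment> \<open>Measures are compared on Borel sets, so \<open>h\<close> is first replaced by a
    Borel function equal to it almost everywhere.\<close>
  obtain k where k: "k \<in> borel_measurable lborel" and hk: "AE s in lborel. h s = k s"
    using completion_ex_borel_measurable_real[of h lborel] int by auto
  have kleb: "k \<in> borel_measurable lebesgue"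
    using k by (rule measurable_completion)
  have AEk: "AE s in lebesgue. h s = k s"
    using hk by (rule AE_completion)
  have intk: "integrable lborel k"
    using integrable_cong_AE[of h lebesgue k] int kleb AEk k
    by (simp add: integrable_completion)
  have zk: "(LINT s|lborel. indicator {x<..} s * k s) = 0" for x
  proof -
    have m: "(\<lambda>s. indicator {x<..} s * k s) \<in> borel_measurable lborel"
      using k by measurable
    have "(LINT s|lborel. indicator {x<..} s * k s) = (LINT s|lebesgue. indicator {x<..} s * k s)"
      using m by (simp add: integral_completion)
    also have "\<dots> = (LINT s|lebesgue. indicator {x<..} s * h s)"
    proof (rule integral_cong_AE)
      show "(\<lambda>s. indicator {x<..} s * k s) \<in> borel_measurable lebesgue"
        using m by (rule measurable_completion)
      have "h \<in> borel_measurable lebesgue" using int by auto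
      moreover have "(indicator {x<..} :: real \<Rightarrow> real) \<in> borel_measurable lebesgue"
        by (intro borel_measurable_indicator sets_completionI_sets) simp
      ultimately show "(\<lambda>s. indicator {x<..} s * h s) \<in> borel_measurable lebesgue"
        by (intro borel_measurable_times)
      show "AE s in lebesgue. indicat_real {x<..} s * k s = indicat_real {x<..} s * h s"
        using AEk by eventually_elim simp
    qed
    finally show ?thesis using zero by simp
  qed
  let ?p = "\<lambda>s. max 0 (k s)" and ?n = "\<lambda>s. max 0 (- k s)"
  have ip: "integrable lborel ?p" and "in": "integrable lborel ?n"
    using intk by auto
  have em: "emeasure (density lborel (\<lambda>s. ennreal (f s))) {x<..}
        = ennreal (LINT s|lborel. indicator {x<..} s * f s)"
    if f: "integrable lborel f" and nn: "\<And>s. f s \<ge> 0" for f :: "real \<Rightarrow> real" and x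
  proof -
    have "emeasure (density lborel (\<lambda>s. ennreal (f s))) {x<..}
        = (\<integral>\<^sup>+ s. ennreal (f s) * indicator {x<..} s \<partial>lborel)"
      using f by (intro emeasure_density) auto
    also have "\<dots> = (\<integral>\<^sup>+ s. ennreal (indicator {x<..} s * f s) \<partial>lborel)"
      by (intro nn_integral_cong) (auto simp: indicator_def)
    also have "\<dots> = ennreal (LINT s|lborel. indicator {x<..} s * f s)"
      using integrable_real_mult_indicator[of "{x<..}" lborel f] f nn
      by (intro nn_integral_eq_integral) (auto simp: mult.commute)
    finally show ?thesis .
  qed
  have "density lborel (\<lambda>s. ennreal (?p s)) = density lborel (\<lambda>s. ennreal (?n s))"
  proof (rule measure_eqI_lessThan)
    fix x :: real
    have "(LINT s|lborel. indicator {x<..} s * ?p s) - (LINT s|lborel. indicator {x<..} s * ?n s)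
        = (LINT s|lborel. indicator {x<..} s * ?p s - indicator {x<..} s * ?n s)"
      using integrable_real_mult_indicator[of "{x<..}" lborel ?p] ip
        integrable_real_mult_indicator[of "{x<..}" lborel ?n] "in"
      by (intro Bochner_Integration.integral_diff[symmetric]) (auto simp: mult.commute)
    also have "\<dots> = (LINT s|lborel. indicator {x<..} s * k s)"
      by (intro Bochner_Integration.integral_cong) (auto simp: max_def algebra_simps)
    finally show "emeasure (density lborel (\<lambda>s. ennreal (?p s))) {x<..}
        = emeasure (density lborel (\<lambda>s. ennreal (?n s))) {x<..}"
      using em[OF ip] em[OF "in"] zk by simp
    show "emeasure (density lborel (\<lambda>s. ennreal (?p s))) {x<..} < \<infinity>"
      using em[OF ip] by simp
  qed auto
  then have "AE s in lborel. ennreal (?p s) = ennreal (?n s)"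
    using ip "in" by (subst finite_density_unique[symmetric]) (auto simp: nn_integral_eq_integral)
  then have "AE s in lborel. k s = 0"
    by eventually_elim (auto simp: max_def split: if_splits)
  then have "AE s in lebesgue. k s = 0"
    by (rule AE_completion)
  with AEk show ?thesis by eventually_elim simp
qed

section \<open>Continuously differentiable cut-off functions\<close>

lemma DERIV_max_0_square:
  "((\<lambda>x::real. (max 0 x)\<^sup>2) has_real_derivative 2 * max 0 x) (at x)"
proof (cases x "0::real" rule: linorder_cases)
  case less
  have "((\<lambda>x::real. 0) has_real_derivative 2 * max 0 x) (at x)"
    using less by simp
  then show ?thesis
    by (rule DERIV_cong_ev[THEN iffD1, rotated -1])
      (use less in \<open>auto intro!: eventually_mono[OF eventually_nhds_in_open[of "{..<0}"]]\<close>)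
next
  case equal
  have "((\<lambda>h. (max 0 h)\<^sup>2 / h) \<longlongrightarrow> 0) (at (0::real))"
  proof (rule Lim_null_comparison)
    show "\<forall>\<^sub>F h in at (0::real). norm ((max 0 h)\<^sup>2 / h) \<le> \<bar>h\<bar>"
      by (auto simp: eventually_at_filter max_def power2_eq_square)
    show "((\<lambda>h. \<bar>h\<bar>) \<longlongrightarrow> 0) (at (0::real))"
      by (intro tendsto_eq_intros refl) auto
  qed
  then show ?thesis using equal by (simp add: DERIV_def)
next
  case greater
  have "((\<lambda>x::real. x\<^sup>2) has_real_derivative 2 * max 0 x) (at x)"
    using greater by (auto intro!: derivative_eq_intros)
  then show ?thesis
    by (rule DERIV_cong_ev[THEN iffD1, rotated -1])
      (use greater in \<open>auto intro!: eventually_mono[OF eventually_nhds_in_open[of "{0<..}"]]\<close>)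
qed

text \<open>Second differences of \<open>(max 0 x)\<^sup>2\<close>, the simplest C1 function that glues to zero, give a
  C1 step from 0 to 1 on \<open>[0,1]\<close>.\<close>

definition smoothstep :: "real \<Rightarrow> real" where
  "smoothstep x = 2 * (max 0 x)\<^sup>2 - 4 * (max 0 (x - 1/2))\<^sup>2 + 2 * (max 0 (x - 1))\<^sup>2"

text \<open>The derivative of \<open>smoothstep\<close>: a triangle of height 2 over [0,1], hence of
  mass 1. Rescaled, it serves as an averaging kernel.\<close>

definition tent :: "real \<Rightarrow> real" where
  "tent x = 4 * max 0 x - 8 * max 0 (x - 1/2) + 4 * max 0 (x - 1)"

lemma DERIV_smoothstep: "(smoothstep has_real_derivative tent x) (at x)"
  unfolding smoothstep_def[abs_def] tent_def
proof -
  have "((\<lambda>x. (max 0 (x - c))\<^sup>2) has_real_derivative 2 * max 0 (x - c)) (at x)" for c :: real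
  proof -
    have "((\<lambda>x. x - c) has_real_derivative 1) (at x)"
      by (auto intro!: derivative_eq_intros)
    from DERIV_chain2[OF DERIV_max_0_square this] show ?thesis by simp
  qed
  note D = this[of 0, simplified] this[of "1/2"] this[of 1]
  show "((\<lambda>x. 2 * (max 0 x)\<^sup>2 - 4 * (max 0 (x - 1/2))\<^sup>2 + 2 * (max 0 (x - 1))\<^sup>2)
      has_real_derivative 4 * max 0 x - 8 * max 0 (x - 1/2) + 4 * max 0 (x - 1)) (at x)"
    by (rule DERIV_cong[OF DERIV_add[OF DERIV_diff[OF DERIV_cmult[OF D(1)] DERIV_cmult[OF D(2)]] DERIV_cmult[OF D(3)]]])
      simp
qed

lemma tent_nonneg: "tent x \<ge> 0"
  by (auto simp: tent_def max_def)

lemma continuous_tent: "continuous_on S tent"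
  unfolding tent_def[abs_def] by (intro continuous_intros)

lemma smoothstep_eq_0: "x \<le> 0 \<Longrightarrow> smoothstep x = 0"
  by (auto simp: smoothstep_def max_def)

lemma smoothstep_eq_1: "x \<ge> 1 \<Longrightarrow> smoothstep x = 1"
  by (auto simp: smoothstep_def max_def power2_eq_square algebra_simps)

lemma tent_eq_0: "x \<le> 0 \<or> x \<ge> 1 \<Longrightarrow> tent x = 0"
  by (auto simp: tent_def max_def)

lemma smoothstep_mono: "x \<le> y \<Longrightarrow> smoothstep x \<le> smoothstep y"
  by (rule DERIV_nonneg_imp_nondecreasing) (use DERIV_smoothstep tent_nonneg in blast)+

lemma smoothstep_bounds: "0 \<le> smoothstep x" "smoothstep x \<le> 1"
  using smoothstep_mono[of "min 0 x" x] smoothstep_mono[of x "max 1 x"]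
  by (simp_all add: smoothstep_eq_0 smoothstep_eq_1)

text \<open>For \<delta> > 0 and c \<le> e this is a plateau: it climbs from 0 to 1 on
  [c - \<delta>, c], equals 1 on [c, e] and descends on [e, e + \<delta>]. Its derivative is the
  difference of two averaging kernels, one next to each end.\<close>

definition bump :: "real \<Rightarrow> real \<Rightarrow> real \<Rightarrow> real \<Rightarrow> real" where
  "bump \<delta> c e s = smoothstep ((s - (c - \<delta>)) / \<delta>) - smoothstep ((s - e) / \<delta>)"

lemma DERIV_smoothstep_scaled:
  assumes "\<delta> > 0"
  shows "((\<lambda>s. smoothstep ((s - c) / \<delta>)) has_real_derivative tent ((s - c) / \<delta>) / \<delta>) (at s)"
proof -
  have "((\<lambda>s. (s - c) / \<delta>) has_real_derivative 1 / \<delta>) (at s)"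
    using assms by (auto intro!: derivative_eq_intros)
  from DERIV_chain2[OF DERIV_smoothstep this] show ?thesis by simp
qed

lemma DERIV_bump:
  assumes "\<delta> > 0"
  shows "(bump \<delta> c e has_real_derivative
    tent ((s - (c - \<delta>)) / \<delta>) / \<delta> - tent ((s - e) / \<delta>) / \<delta>) (at s)"
  unfolding bump_def[abs_def]
  by (intro DERIV_diff DERIV_smoothstep_scaled assms)

lemma C1_differentiable_onI_real:
  fixes f f' :: "real \<Rightarrow> real"
  assumes "\<And>s. (f has_real_derivative f' s) (at s)" and "continuous_on UNIV f'"
  shows "f C1_differentiable_on UNIV"
  using assms unfolding C1_differentiable_on_def has_real_derivative_iff_has_vector_derivative by auto

lemma bump_eq_0:
  assumes "\<delta> > 0" "c \<le> e" "s \<notin> {c - \<delta>..e + \<delta>}"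
  shows "bump \<delta> c e s = 0"
proof (cases "s < c - \<delta>")
  case True
  then show ?thesis using assms
    by (simp add: bump_def smoothstep_eq_0 divide_nonpos_pos)
next
  case False
  then have "s > e + \<delta>" using assms by auto
  then show ?thesis using assms
    by (simp add: bump_def smoothstep_eq_1)
qed

lemma test_function_bump:
  assumes "\<delta> > 0" "a < c - \<delta>" "c \<le> e" "e + \<delta> < b"
  shows "test_function a b (bump \<delta> c e)"
proof -
  have "continuous_on UNIV (\<lambda>s. tent ((s - (c - \<delta>)) / \<delta>) / \<delta> - tent ((s - e) / \<delta>) / \<delta>)"
    using assms by (intro continuous_intros continuous_on_compose2[OF continuous_tent[of UNIV]]) auto
  then have "bump \<delta> c e C1_differentiable_on UNIV"
    by (rule C1_differentiable_onI_real[OF DERIV_bump, OF assms(1)])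
  moreover have "c - \<delta> \<le> e + \<delta>" using assms by simp
  ultimately show ?thesis
    unfolding test_function_def using assms bump_eq_0 by blast
qed

lemma bump_abs_le_1: "\<bar>bump \<delta> c e s\<bar> \<le> 1"
  using smoothstep_bounds[of "(s - (c - \<delta>)) / \<delta>"] smoothstep_bounds[of "(s - e) / \<delta>"]
  by (auto simp: bump_def)

text \<open>At each point the sequence is eventually constant: the plateau value 1 on [c, e], and 0
  once \<open>D n\<close> is below the distance from the point to that interval.\<close>

lemma bump_tendsto:
  assumes "c \<le> e" and D: "D \<longlonglongrightarrow> 0" and pos: "\<And>n. D n > 0"
  shows "(\<lambda>n. bump (D n) c e s) \<longlonglongrightarrow> indicator {c..e} s"
proof (rule tendsto_eventually)
  consider "s < c" | "c \<le> s" "s \<le> e" | "e < s" by linarith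
  then show "\<forall>\<^sub>F n in sequentially. bump (D n) c e s = indicator {c..e} s"
  proof cases
    case 1
    have "\<forall>\<^sub>F n in sequentially. D n < c - s"
      using order_tendstoD(2)[OF D, of "c - s"] 1 by simp
    then show ?thesis
      by eventually_elim (use 1 assms bump_eq_0[OF pos \<open>c \<le> e\<close>] in \<open>auto simp: indicator_def\<close>)
  next
    case 2
    have "bump (D n) c e s = 1" for n
      using 2 pos[of n] by (simp add: bump_def smoothstep_eq_1 smoothstep_eq_0 divide_nonpos_pos)
    then show ?thesis using 2 by simp
  next
    case 3
    have "\<forall>\<^sub>F n in sequentially. D n < s - e"
      using order_tendstoD(2)[OF D, of "s - e"] 3 by simp
    then show ?thesis
      by eventually_elim (use 3 assms bump_eq_0[OF pos \<open>c \<le> e\<close>] in \<open>auto simp: indicator_def\<close>)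
  qed
qed

text \<open>The rescaled tent is a nonnegative kernel of mass 1 that vanishes off [c, c + \<delta>],
  so the integral is a weighted mean of the values of \<open>F\<close> there.\<close>

lemma tent_average:
  fixes F :: "real \<Rightarrow> real"
  assumes F: "continuous_on {a..b} F" and d: "\<delta> > 0" "a \<le> c" "c + \<delta> \<le> b"
    and close: "\<And>s. c \<le> s \<Longrightarrow> s \<le> c + \<delta> \<Longrightarrow> \<bar>F s - L\<bar> \<le> \<eta>"
  shows "\<bar>integral {a..b} (\<lambda>s. F s * (tent ((s - c) / \<delta>) / \<delta>)) - L\<bar> \<le> \<eta>"
proof -
  let ?k = "\<lambda>s. tent ((s - c) / \<delta>) / \<delta>"
  have k0: "?k s = 0" if "s \<notin> {c..c + \<delta>}" for s
  proof -
    have "(s - c) / \<delta> \<le> 0 \<or> (s - c) / \<delta> \<ge> 1"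
      using that d by (auto simp: field_simps)
    then show ?thesis by (simp add: tent_eq_0)
  qed
  have ck: "continuous_on {a..b} ?k"
    using d by (intro continuous_intros continuous_on_compose2[OF continuous_tent[of UNIV]]) auto
  have "(?k has_integral smoothstep ((b - c) / \<delta>) - smoothstep ((a - c) / \<delta>)) {a..b}"
    using d by (intro fundamental_theorem_of_calculus)
      (auto intro!: has_field_derivative_at_within[OF DERIV_smoothstep_scaled]
        simp flip: has_real_derivative_iff_has_vector_derivative)
  moreover have "smoothstep ((b - c) / \<delta>) = 1" "smoothstep ((a - c) / \<delta>) = 0"
    using d by (auto intro!: smoothstep_eq_1 smoothstep_eq_0 simp: field_simps)
  ultimately have k1: "(?k has_integral 1) {a..b}" by simp
  have i1: "(\<lambda>s. F s * ?k s) integrable_on {a..b}"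
    by (intro integrable_continuous_real continuous_on_mult F ck)
  have i2: "(\<lambda>s. F s * ?k s - L * ?k s) integrable_on {a..b}"
    by (intro integrable_continuous_real continuous_on_mult continuous_on_diff F ck continuous_on_const)
  have "norm (integral {a..b} (\<lambda>s. F s * ?k s - L * ?k s)) \<le> integral {a..b} (\<lambda>s. \<eta> * ?k s)"
  proof (rule integral_norm_bound_integral[OF i2])
    show "(\<lambda>s. \<eta> * ?k s) integrable_on {a..b}"
      using k1 by (intro integrable_on_mult_right) auto
    fix s
    show "norm (F s * ?k s - L * ?k s) \<le> \<eta> * ?k s"
    proof (cases "s \<in> {c..c + \<delta>}")
      case True
      have nn: "?k s \<ge> 0" using d tent_nonneg by simp
      have "norm (F s * ?k s - L * ?k s) = \<bar>F s - L\<bar> * ?k s"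
        unfolding left_diff_distrib[symmetric] real_norm_def abs_mult abs_of_nonneg[OF nn] ..
      moreover have "\<dots> \<le> \<eta> * ?k s"
        using close[of s] True nn by (intro mult_right_mono) auto
      ultimately show ?thesis by linarith
    qed (simp add: k0)
  qed
  moreover have "integral {a..b} (\<lambda>s. \<eta> * ?k s) = \<eta>"
    by (rule integral_unique[OF has_integral_mult_right[OF k1, of \<eta>, unfolded mult_1_right]])
  moreover have "integral {a..b} (\<lambda>s. F s * ?k s - L * ?k s) = integral {a..b} (\<lambda>s. F s * ?k s) - L"
    using has_integral_diff[OF integrable_integral[OF i1] has_integral_mult_right[OF k1, of L]]
    by (simp add: integral_unique)
  ultimately show ?thesis by simp
qed

section \<open>The fundamental theorem of calculus for weak derivatives\<close>

lemma lebesgue_on_continuous_integral: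
  fixes f :: "real \<Rightarrow> real"
  assumes "continuous_on {a..b} f"
  shows "integrable (lebesgue_on {a..b}) f" "(LINT s|lebesgue_on {a..b}. f s) = integral {a..b} f"
  using continuous_imp_integrable_real[OF assms] by (auto simp: lebesgue_integral_eq_integral)

text \<open>Test with ever steeper bumps over [c, e]. Against \<open>F\<close> their derivatives
  average the values near c minus the values near e; against \<open>d\<close> the bumps tend to the
  indicator, by dominated convergence. The points are interior so that the bumps are test
  functions.\<close>

lemma weak_deriv_integral_interior:
  assumes wd: "weak_deriv a b F d" and F: "continuous_on {a..b} F"
    and d: "integrable (lebesgue_on {a..b}) d" and c: "a < c" "c \<le> e" "e < b"
  shows "integral {c..e} d = F e - F c"
proof -
  \<comment> \<open>The divisor is at least 2, so already the first bump has its support strictly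
    inside (a, b).\<close>
  define D where "D n = min (c - a) (b - e) / real (n + 2)" for n
  have pos: "D n > 0" for n using c by (simp add: D_def)
  have D0: "D \<longlonglongrightarrow> 0" unfolding D_def by real_asymp
  have small: "D n < c - a" "D n < b - e" for n
  proof -
    have "m / real (n + 2) < m" if "m > 0" for m
      using that by (simp add: divide_less_eq)
    from this[of "min (c - a) (b - e)"] have "D n < min (c - a) (b - e)"
      using c unfolding D_def by simp
    then show "D n < c - a" "D n < b - e" by auto
  qed
  let ?M = "lebesgue_on {a..b}"
  let ?L = "\<lambda>\<delta> c s. tent ((s - c) / \<delta>) / \<delta>"
  have eq: "integral {a..b} (\<lambda>s. F s * ?L (D n) (c - D n) s) - integral {a..b} (\<lambda>s. F s * ?L (D n) e s)
      = - (LINT s|?M. d s * bump (D n) c e s)" for n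
  proof -
    have tf: "test_function a b (bump (D n) c e)"
      using small[of n] pos[of n] c by (intro test_function_bump) auto
    have dv: "deriv (bump (D n) c e) s = ?L (D n) (c - D n) s - ?L (D n) e s" for s
      using DERIV_bump[OF pos] by (rule DERIV_imp_deriv)
    have cont: "continuous_on {a..b} (\<lambda>s. F s * ?L (D n) c' s)" for c'
      using pos[of n]
      by (intro continuous_intros F continuous_on_compose2[OF continuous_tent[of UNIV]]) auto
    have "(LINT s|?M. F s * deriv (bump (D n) c e) s)
        = (LINT s|?M. F s * ?L (D n) (c - D n) s - F s * ?L (D n) e s)"
      by (simp add: dv right_diff_distrib)
    also have "\<dots> = integral {a..b} (\<lambda>s. F s * ?L (D n) (c - D n) s)
        - integral {a..b} (\<lambda>s. F s * ?L (D n) e s)"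
      unfolding lebesgue_on_continuous_integral(2)[OF cont, symmetric]
      by (intro Bochner_Integration.integral_diff lebesgue_on_continuous_integral(1) cont)
    finally show ?thesis using wd tf unfolding weak_deriv_def by auto
  qed
  \<comment> \<open>The two kernels live on [c - D n, c] and [e, e + D n]. The general left end
    \<open>C n\<close> covers both placements.\<close>
  have lim: "(\<lambda>n. integral {a..b} (\<lambda>s. F s * ?L (D n) (C n) s)) \<longlonglongrightarrow> F c'"
    if C: "\<And>n. a \<le> C n" "\<And>n. C n + D n \<le> b" "\<And>n. \<bar>C n - c'\<bar> \<le> D n" and c': "c' \<in> {a..b}" for C c'
  proof (rule LIMSEQ_I)
    fix r :: real assume "r > 0"
    then obtain \<epsilon> where \<epsilon>: "\<epsilon> > 0" "\<And>s. s \<in> {a..b} \<Longrightarrow> \<bar>s - c'\<bar> < \<epsilon> \<Longrightarrow> \<bar>F s - F c'\<bar> < r / 2"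
      using F c' unfolding continuous_on_iff dist_real_def by (metis half_gt_zero)
    have "\<forall>\<^sub>F n in sequentially. D n < \<epsilon> / 2"
      using order_tendstoD(2)[OF D0, of "\<epsilon> / 2"] \<epsilon> by simp
    then obtain N where N: "\<And>n. n \<ge> N \<Longrightarrow> D n < \<epsilon> / 2" by (auto simp: eventually_sequentially)
    have "\<bar>integral {a..b} (\<lambda>s. F s * ?L (D n) (C n) s) - F c'\<bar> \<le> r / 2" if "n \<ge> N" for n
    proof (rule tent_average[OF F pos C(1) C(2)])
      fix s assume "C n \<le> s" "s \<le> C n + D n"
      then show "\<bar>F s - F c'\<bar> \<le> r / 2"
        using C(1,2,3)[of n] N[OF that] by (intro less_imp_le \<epsilon>(2)) auto
    qed
    then show "\<exists>N. \<forall>n\<ge>N. norm (integral {a..b} (\<lambda>s. F s * ?L (D n) (C n) s) - F c') < r"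
      using \<open>r > 0\<close> by (intro exI[of _ N]) force
  qed
  have "(\<lambda>n. integral {a..b} (\<lambda>s. F s * ?L (D n) (c - D n) s)
      - integral {a..b} (\<lambda>s. F s * ?L (D n) e s)) \<longlonglongrightarrow> F c - F e"
  proof (intro tendsto_diff lim)
    show "a \<le> c - D n" "c - D n + D n \<le> b" "\<bar>c - D n - c\<bar> \<le> D n"
      "a \<le> e" "e + D n \<le> b" "\<bar>e - e\<bar> \<le> D n" for n
      using small[of n] pos[of n] c by auto
  qed (use c in auto)
  moreover have "(\<lambda>n. - (LINT s|?M. d s * bump (D n) c e s))
      \<longlonglongrightarrow> - (LINT s|?M. d s * indicator {c..e} s)"
  proof (intro tendsto_minus integral_dominated_convergence[where w = "\<lambda>s. \<bar>d s\<bar>"])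
    have "continuous_on UNIV (bump (D n) c e)" for n
      using DERIV_bump[OF pos] by (intro DERIV_continuous_on) (blast intro: has_field_derivative_at_within)
    then have "bump (D n) c e \<in> borel_measurable ?M" for n
      by (intro continuous_imp_measurable_on_sets_lebesgue) (auto intro: continuous_on_subset)
    then show "(\<lambda>s. d s * bump (D n) c e s) \<in> borel_measurable ?M" for n
      using d by (intro borel_measurable_times) auto
    show "(\<lambda>s. d s * indicator {c..e} s) \<in> borel_measurable ?M"
      using d by (intro borel_measurable_times borel_measurable_integrable
          measurable_restrict_space1[OF borel_measurable_indicator]) auto
    show "integrable ?M (\<lambda>s. \<bar>d s\<bar>)" using d by simp
    show "AE s in ?M. (\<lambda>n. d s * bump (D n) c e s) \<longlonglongrightarrow> d s * indicator {c..e} s"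
      using bump_tendsto[OF c(2) D0 pos] by (auto intro!: tendsto_mult)
    show "AE s in ?M. norm (d s * bump (D n) c e s) \<le> \<bar>d s\<bar>" for n
      using bump_abs_le_1 by (auto simp: abs_mult intro!: AE_I2 mult_left_le)
  qed
  ultimately have "- (LINT s|?M. d s * indicator {c..e} s) = F c - F e"
    unfolding eq by (rule LIMSEQ_unique[rotated])
  moreover have "(LINT s|?M. d s * indicator {c..e} s) = integral {c..e} d"
  proof -
    have "integrable ?M (\<lambda>s. d s * indicator {c..e} s)"
      using d c by (intro integrable_real_mult_indicator) (auto simp: sets_restrict_space_iff)
    then have "(LINT s|?M. d s * indicator {c..e} s) = integral {a..b} (\<lambda>s. d s * indicator {c..e} s)"
      by (simp add: lebesgue_integral_eq_integral)
    also have "\<dots> = integral {a..b} (\<lambda>s. if s \<in> {c..e} then d s else 0)"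
      by (intro integral_cong) (auto simp: indicator_def)
    also have "\<dots> = integral {c..e} d"
      using c by (simp only: Henstock_Kurzweil_Integration.integral_restrict_Int) (simp add: max_absorb1 min_absorb1)
    finally show ?thesis .
  qed
  ultimately show ?thesis by simp
qed

text \<open>By the interior case \<open>F\<close> minus the indefinite integral of \<open>d\<close>
  is constant on the open interval, and by continuity on the closed one. Including the end points
  gives access to time 0 and to both ends of the delay interval.\<close>

lemma weak_deriv_has_integral:
  assumes wd: "weak_deriv a b F d" and F: "continuous_on {a..b} F"
    and d: "integrable (lebesgue_on {a..b}) d" and ab: "a < b" and c: "a \<le> c" "c \<le> e" "e \<le> b"
  shows "(d has_integral F e - F c) {c..e}"
proof -
  have di: "d integrable_on {a..b}" using d by (intro integrable_on_lebesgue_on) auto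
  let ?H = "\<lambda>x. F x - integral {a..x} d"
  let ?m = "(a + b) / 2"
  have comb: "integral {a..u} d + integral {u..v} d = integral {a..v} d"
    if "a \<le> u" "u \<le> v" "v \<le> b" for u v
    using that di by (intro Henstock_Kurzweil_Integration.integral_combine)
      (auto intro: integrable_subinterval_real)
  have contH: "continuous_on (closure {a<..<b}) ?H"
    using ab F indefinite_integral_continuous_1[OF di] by (auto intro!: continuous_on_diff)
  have int: "?H x = ?H ?m" if "x \<in> {a<..<b}" for x
  proof (cases "x \<le> ?m")
    case True
    then show ?thesis
      using weak_deriv_integral_interior[OF wd F d, of x ?m] comb[of x ?m] that by auto
  next
    case False
    then show ?thesis
      using weak_deriv_integral_interior[OF wd F d, of ?m x] comb[of ?m x] that by auto
  qed
  have "?H x = ?H ?m" if "x \<in> {a..b}" for x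
    using continuous_constant_on_closure[OF contH int, of x] that ab by simp
  from this[of c] this[of e] have "integral {c..e} d = F e - F c"
    using comb[of c e] c by simp
  moreover have "d integrable_on {c..e}"
    using c by (intro integrable_subinterval_real[OF di]) auto
  ultimately show ?thesis by (simp add: has_integral_iff)
qed

text \<open>After extension by zero, a half-line integral is an integral over
  \<open>{max a x..b}\<close>, up to the single point \<open>x\<close>.\<close>

lemma AE_eq_0_of_interval_integrals:
  fixes h :: "real \<Rightarrow> real"
  assumes h: "integrable (lebesgue_on {a..b}) h"
    and zero: "\<And>c. a \<le> c \<Longrightarrow> c \<le> b \<Longrightarrow> integral {c..b} h = 0"
  shows "AE s in lebesgue_on {a..b}. h s = 0"
proof -
  let ?h = "\<lambda>s. if s \<in> {a..b} then h s else 0"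
  have int: "integrable lebesgue ?h"
    using h by (subst Lebesgue_Measure.integrable_restrict_UNIV) auto
  have "AE s in lebesgue. ?h s = 0"
  proof (rule AE_eq_0_of_half_line_integrals[OF int])
    fix x
    have "integrable lebesgue (\<lambda>s. indicator {x<..} s * ?h s)"
      using integrable_real_mult_indicator[OF _ int, of "{x<..}"] by (simp add: mult.commute)
    then have "(LINT s|lebesgue. indicator {x<..} s * ?h s) = integral UNIV (\<lambda>s. indicator {x<..} s * ?h s)"
      by (simp add: integral_lebesgue)
    also have "\<dots> = integral UNIV (\<lambda>s. if s \<in> {max a x..b} then h s else 0)"
      by (rule integral_spike[of "{x}"]) (auto simp: indicator_def)
    also have "\<dots> = integral {max a x..b} h"
      by (rule Henstock_Kurzweil_Integration.integral_restrict_UNIV)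
    also have "\<dots> = 0"
      using zero[of "max a x"] by (cases "max a x \<le> b") auto
    finally show "(LINT s|lebesgue. indicator {x<..} s * ?h s) = 0" .
  qed
  then have "AE s in lebesgue. s \<in> {a..b} \<longrightarrow> h s = 0"
    by eventually_elim auto
  then show ?thesis by (subst AE_restrict_space_iff) auto
qed

section \<open>Square-integrable functions and the domain of the generator\<close>

lemma L2_mult_integrable:
  assumes "L2 a b f" "L2 a b g"
  shows "integrable (lebesgue_on {a..b}) (\<lambda>s. f s * g s)"
proof (rule Bochner_Integration.integrable_bound)
  show "integrable (lebesgue_on {a..b}) (\<lambda>s. (f s)\<^sup>2 + (g s)\<^sup>2)"
    using assms by (auto simp: L2_def)
  show "(\<lambda>s. f s * g s) \<in> borel_measurable (lebesgue_on {a..b})"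
    using assms by (auto simp: L2_def)
  show "AE s in lebesgue_on {a..b}. norm (f s * g s) \<le> norm ((f s)\<^sup>2 + (g s)\<^sup>2)"
  proof (rule AE_I2)
    fix s
    have "2 * (\<bar>f s\<bar> * \<bar>g s\<bar>) \<le> (f s)\<^sup>2 + (g s)\<^sup>2"
      using sum_squares_bound[of "\<bar>f s\<bar>" "\<bar>g s\<bar>"] by simp
    moreover have "0 \<le> \<bar>f s\<bar> * \<bar>g s\<bar>" by simp
    ultimately show "norm (f s * g s) \<le> norm ((f s)\<^sup>2 + (g s)\<^sup>2)"
      unfolding real_norm_def abs_mult by linarith
  qed
qed

lemma L2_continuous:
  assumes "continuous_on {a..b} f"
  shows "L2 a b f"
proof -
  have "integrable (lebesgue_on {a..b}) (\<lambda>s. (f s)\<^sup>2)"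
    by (intro lebesgue_on_continuous_integral continuous_on_power assms)
  moreover have "f \<in> borel_measurable (lebesgue_on {a..b})"
    using lebesgue_on_continuous_integral(1)[OF assms] by simp
  ultimately show ?thesis by (simp add: L2_def)
qed

lemma L2_integrable: "L2 a b f \<Longrightarrow> integrable (lebesgue_on {a..b}) f"
  using L2_mult_integrable[OF _ L2_continuous[of a b "\<lambda>_. 1"], of f] by simp

lemma L2_linear_combination:
  assumes "L2 a b f" "L2 a b g"
  shows "L2 a b (\<lambda>s. p * f s + q * g s)"
proof -
  have "integrable (lebesgue_on {a..b}) (\<lambda>s. p\<^sup>2 * (f s)\<^sup>2 + 2 * p * q * (f s * g s) + q\<^sup>2 * (g s)\<^sup>2)"
    using assms L2_mult_integrable[OF assms] by (auto simp: L2_def)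
  moreover have "(\<lambda>s. p\<^sup>2 * (f s)\<^sup>2 + 2 * p * q * (f s * g s) + q\<^sup>2 * (g s)\<^sup>2)
      = (\<lambda>s. (p * f s + q * g s)\<^sup>2)"
    by (simp add: power2_eq_square algebra_simps)
  ultimately show ?thesis using assms by (auto simp: L2_def)
qed

section \<open>Test functions, integration by parts and the exponential product rule\<close>

lemma test_functionD:
  assumes "test_function a b \<theta>"
  shows "(\<theta> has_real_derivative deriv \<theta> s) (at s)" "continuous_on S (deriv \<theta>)"
    "continuous_on S \<theta>" "\<theta> a = 0" "\<theta> b = 0"
proof -
  obtain D where D: "\<And>s. (\<theta> has_real_derivative D s) (at s)" "continuous_on UNIV D"
    using assms unfolding test_function_def C1_differentiable_on_def
      has_real_derivative_iff_has_vector_derivative by auto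
  have "deriv \<theta> = D" using DERIV_imp_deriv[OF D(1)] by auto
  with D show "(\<theta> has_real_derivative deriv \<theta> s) (at s)" "continuous_on S (deriv \<theta>)"
    by (auto intro: continuous_on_subset)
  show "continuous_on S \<theta>"
    using D(1) DERIV_isCont continuous_at_imp_continuous_on by blast
  show "\<theta> a = 0" "\<theta> b = 0" using assms unfolding test_function_def by auto
qed

lemma test_function_mult:
  assumes "test_function a b \<theta>" "\<And>s. (w has_real_derivative w' s) (at s)" "continuous_on UNIV w'"
  shows "test_function a b (\<lambda>s. w s * \<theta> s)"
    "deriv (\<lambda>s. w s * \<theta> s) s = w s * deriv \<theta> s + w' s * \<theta> s"
proof -
  have D: "((\<lambda>s. w s * \<theta> s) has_real_derivative w s * deriv \<theta> s + w' s * \<theta> s) (at s)" for s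
    using DERIV_mult[OF assms(2) test_functionD(1)[OF assms(1)], of s] by (simp add: add.commute mult.commute)
  then show "deriv (\<lambda>s. w s * \<theta> s) s = w s * deriv \<theta> s + w' s * \<theta> s"
    by (rule DERIV_imp_deriv)
  have "continuous_on UNIV w"
    using assms(2) DERIV_isCont continuous_at_imp_continuous_on by blast
  then have "(\<lambda>s. w s * \<theta> s) C1_differentiable_on UNIV"
    by (intro C1_differentiable_onI_real[OF D] continuous_intros assms(3)
        test_functionD(2)[OF assms(1)] test_functionD(3)[OF assms(1)])
  then show "test_function a b (\<lambda>s. w s * \<theta> s)"
    using assms(1) unfolding test_function_def by auto
qed

lemma weak_deriv_C1:
  assumes D: "\<And>s. (\<phi> has_real_derivative \<phi>' s) (at s)" and c: "continuous_on UNIV \<phi>'" and "a \<le> b"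
  shows "weak_deriv a b \<phi> \<phi>'"
  unfolding weak_deriv_def
proof (intro allI impI)
  fix \<theta> assume t: "test_function a b \<theta>"
  have c\<phi>: "continuous_on {a..b} \<phi>"
    using D DERIV_isCont continuous_at_imp_continuous_on by blast
  note cont = continuous_on_subset[OF c, of "{a..b}", simplified] c\<phi> test_functionD(2,3)[OF t, of "{a..b}"]
  have c1: "continuous_on {a..b} (\<lambda>s. \<phi> s * deriv \<theta> s)" and c2: "continuous_on {a..b} (\<lambda>s. \<phi>' s * \<theta> s)"
    by (auto intro!: continuous_on_mult cont)
  have "((\<lambda>s. \<phi> s * deriv \<theta> s + \<phi>' s * \<theta> s) has_integral \<phi> b * \<theta> b - \<phi> a * \<theta> a) {a..b}"
  proof (rule fundamental_theorem_of_calculus[OF \<open>a \<le> b\<close>])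
    fix s
    have "((\<lambda>s. \<phi> s * \<theta> s) has_real_derivative \<phi> s * deriv \<theta> s + \<phi>' s * \<theta> s) (at s)"
      using DERIV_mult[OF D test_functionD(1)[OF t], of s] by (simp add: add.commute mult.commute)
    then show "((\<lambda>s. \<phi> s * \<theta> s) has_vector_derivative \<phi> s * deriv \<theta> s + \<phi>' s * \<theta> s) (at s within {a..b})"
      using has_field_derivative_at_within has_real_derivative_iff_has_vector_derivative by blast
  qed
  then have "integral {a..b} (\<lambda>s. \<phi> s * deriv \<theta> s + \<phi>' s * \<theta> s) = 0"
    using test_functionD(4,5)[OF t] by (simp add: integral_unique)
  moreover have "integral {a..b} (\<lambda>s. \<phi> s * deriv \<theta> s + \<phi>' s * \<theta> s)
      = integral {a..b} (\<lambda>s. \<phi> s * deriv \<theta> s) + integral {a..b} (\<lambda>s. \<phi>' s * \<theta> s)"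
    by (intro Henstock_Kurzweil_Integration.integral_add integrable_continuous_real c1 c2)
  ultimately show "(LINT s|lebesgue_on {a..b}. \<phi> s * deriv \<theta> s) = - (LINT s|lebesgue_on {a..b}. \<phi>' s * \<theta> s)"
    using lebesgue_on_continuous_integral(2)[OF c1] lebesgue_on_continuous_integral(2)[OF c2] by simp
qed

text \<open>The exponential factor is moved onto the test function: the product of the two is again
  a test function, and the classical product rule for it yields the additional term with
  \<open>r\<close>.\<close>

lemma weak_deriv_exp_mult:
  assumes wd: "weak_deriv a b F d" and F: "continuous_on {a..b} F"
    and d: "integrable (lebesgue_on {a..b}) d"
  shows "weak_deriv a b (\<lambda>s. exp (r * s) * F s) (\<lambda>s. exp (r * s) * (d s + r * F s))"
  unfolding weak_deriv_def
proof (intro allI impI)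
  fix \<theta> assume t: "test_function a b \<theta>"
  let ?M = "lebesgue_on {a..b}"
  have D: "((\<lambda>s. exp (r * s)) has_real_derivative r * exp (r * s)) (at s)" for s
    by (auto intro!: derivative_eq_intros)
  have cD: "continuous_on UNIV (\<lambda>s. r * exp (r * s))" by (intro continuous_intros)
  note tm = test_function_mult[OF t D cD]
  have ce: "continuous_on {a..b} (\<lambda>s. exp (r * s))" by (intro continuous_intros)
  have i1: "integrable ?M (\<lambda>s. F s * (exp (r * s) * deriv \<theta> s))"
    and i2: "integrable ?M (\<lambda>s. F s * (r * exp (r * s) * \<theta> s))"
    by (intro lebesgue_on_continuous_integral(1) continuous_intros F test_functionD[OF t])+
  have "continuous_on {a..b} (\<lambda>s. exp (r * s) * \<theta> s)"
    by (intro continuous_intros test_functionD[OF t])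
  then have mea: "(\<lambda>s. exp (r * s) * \<theta> s) \<in> borel_measurable ?M"
    and bdd: "bounded ((\<lambda>s. exp (r * s) * \<theta> s) ` {a..b})"
    using lebesgue_on_continuous_integral(1) compact_continuous_image compact_imp_bounded by blast+
  have i3: "integrable ?M (\<lambda>s. d s * (exp (r * s) * \<theta> s))"
  proof -
    obtain B where B: "\<And>s. s \<in> {a..b} \<Longrightarrow> \<bar>exp (r * s) * \<theta> s\<bar> \<le> B"
      using bdd unfolding bounded_iff by (metis imageI real_norm_def)
    show ?thesis
    proof (rule Bochner_Integration.integrable_bound)
      show "integrable ?M (\<lambda>s. B * d s)" using d by simp
      show "(\<lambda>s. d s * (exp (r * s) * \<theta> s)) \<in> borel_measurable ?M"
        by (rule borel_measurable_times[OF borel_measurable_integrable[OF d] mea])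
      show "AE s in ?M. norm (d s * (exp (r * s) * \<theta> s)) \<le> norm (B * d s)"
      proof (rule AE_I2)
        fix s assume "s \<in> space ?M"
        then have "\<bar>exp (r * s) * \<theta> s\<bar> \<le> \<bar>B\<bar>" using B[of s] by force
        then show "norm (d s * (exp (r * s) * \<theta> s)) \<le> norm (B * d s)"
          unfolding real_norm_def abs_mult[of "d s"] abs_mult[of B] mult.commute[of "\<bar>B\<bar>"]
          by (intro mult_left_mono) auto
      qed
    qed
  qed
  have "(LINT s|?M. F s * deriv (\<lambda>s. exp (r * s) * \<theta> s) s) = - (LINT s|?M. d s * (exp (r * s) * \<theta> s))"
    using wd tm(1) unfolding weak_deriv_def by auto
  then have "(LINT s|?M. F s * (exp (r * s) * deriv \<theta> s)) + (LINT s|?M. F s * (r * exp (r * s) * \<theta> s))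
      = - (LINT s|?M. d s * (exp (r * s) * \<theta> s))"
    using Bochner_Integration.integral_add[OF i1 i2] by (simp add: tm(2) distrib_left)
  moreover have "(LINT s|?M. d s * (exp (r * s) * \<theta> s)) + (LINT s|?M. F s * (r * exp (r * s) * \<theta> s))
      = (LINT s|?M. exp (r * s) * (d s + r * F s) * \<theta> s)"
    using Bochner_Integration.integral_add[OF i3 i2] by (simp add: algebra_simps)
  ultimately show "(LINT s|?M. exp (r * s) * F s * deriv \<theta> s)
      = - (LINT s|?M. exp (r * s) * (d s + r * F s) * \<theta> s)"
    by (simp add: mult.left_commute mult.assoc)
qed

section \<open>Continuously differentiable elements of the domain, the only ones used to probe the
  state equation\<close>

lemma domA_C1:
  assumes D: "\<And>s. (\<phi> has_real_derivative \<phi>' s) (at s)" and c: "continuous_on UNIV \<phi>'" and "T > 0"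
  shows "(\<phi> 0, \<phi>) \<in> domA T"
proof -
  have c\<phi>: "continuous_on {- T..0} \<phi>"
    using D DERIV_isCont continuous_at_imp_continuous_on by blast
  show ?thesis
    unfolding domA_def W12_def
    using c\<phi> L2_continuous[OF c\<phi>] weak_deriv_C1[OF D c, of "- T" 0] \<open>T > 0\<close>
      L2_continuous[OF continuous_on_subset[OF c, of "{- T..0}"]] by auto
qed

text \<open>\<open>opA\<close> picks some weak derivative. Both it and the classical derivative
  integrate over [u, 0] to \<phi>(0) - \<phi>(u), so their difference has vanishing integrals and is
  zero almost everywhere.\<close>

lemma opA_C1:
  assumes D: "\<And>s. (\<phi> has_real_derivative \<phi>' s) (at s)" and c: "continuous_on UNIV \<phi>'" and "T > 0"
  shows "L2 (- T) 0 (snd (opA T (u, \<phi>)))" "AE s in lebesgue_on {- T..0}. snd (opA T (u, \<phi>)) s = \<phi>' s"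
proof -
  define g where "g = snd (opA T (u, \<phi>))"
  have c\<phi>: "continuous_on {- T..0} \<phi>"
    using D DERIV_isCont continuous_at_imp_continuous_on by blast
  have L: "L2 (- T) 0 \<phi>'" using L2_continuous continuous_on_subset[OF c] by blast
  moreover have w: "weak_deriv (- T) 0 \<phi> \<phi>'" using weak_deriv_C1[OF D c] \<open>T > 0\<close> by simp
  ultimately have g: "L2 (- T) 0 g" "weak_deriv (- T) 0 \<phi> g"
    using someI[of "\<lambda>g. L2 (- T) 0 g \<and> weak_deriv (- T) 0 \<phi> g" \<phi>'] unfolding g_def opA_def by auto
  have "AE s in lebesgue_on {- T..0}. g s - \<phi>' s = 0"
  proof (rule AE_eq_0_of_interval_integrals)
    show "integrable (lebesgue_on {- T..0}) (\<lambda>s. g s - \<phi>' s)"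
      using g L by (intro Bochner_Integration.integrable_diff L2_integrable)
    fix u assume u: "- T \<le> u" "u \<le> (0::real)"
    have "(g has_integral \<phi> 0 - \<phi> u) {u..0}" "(\<phi>' has_integral \<phi> 0 - \<phi> u) {u..0}"
      using u g w L \<open>T > 0\<close> by (auto intro!: weak_deriv_has_integral[OF _ c\<phi> L2_integrable])
    from has_integral_diff[OF this] show "integral {u..0} (\<lambda>s. g s - \<phi>' s) = 0"
      by (simp add: integral_unique)
  qed
  then show "AE s in lebesgue_on {- T..0}. snd (opA T (u, \<phi>)) s = \<phi>' s"
    unfolding g_def by eventually_elim simp
  show "L2 (- T) 0 (snd (opA T (u, \<phi>)))" using g unfolding g_def by simp
qed

lemma X_inner_opA_C1:
  assumes D: "\<And>s. (\<phi> has_real_derivative \<phi>' s) (at s)" and c: "continuous_on UNIV \<phi>'" and "T > 0"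
    and z: "z \<in> X_space T"
  shows "X_inner T z (opA T (u, \<phi>)) = X_inner T z (0, \<phi>')"
proof -
  have "L2 (- T) 0 \<phi>'" using L2_continuous continuous_on_subset[OF c] by blast
  then have "(LINT s|lebesgue_on {- T..0}. snd z s * snd (opA T (u, \<phi>)) s)
      = (LINT s|lebesgue_on {- T..0}. snd z s * \<phi>' s)"
    using opA_C1[OF D c \<open>T > 0\<close>, of u] z
    by (intro integral_cong_AE borel_measurable_times) (auto simp: L2_def X_space_def)
  then show ?thesis by (simp add: X_inner_def opA_def)
qed

section \<open>The integrated state equation\<close>

lemma X_space_comb: "\<lbrakk>x \<in> X_space T; z \<in> X_space T\<rbrakk> \<Longrightarrow> X_comb a x b z \<in> X_space T"
  by (simp add: X_space_def X_comb_def L2_linear_combination)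

lemma X_inner_comb_left:
  assumes "x \<in> X_space T" "z \<in> X_space T" "\<psi> \<in> X_space T"
  shows "X_inner T (X_comb a x b z) \<psi> = a * X_inner T x \<psi> + b * X_inner T z \<psi>"
proof -
  note i = L2_mult_integrable[of "- T" 0 "snd x" "snd \<psi>"] L2_mult_integrable[of "- T" 0 "snd z" "snd \<psi>"]
  have "(LINT s|lebesgue_on {- T..0}. a * (snd x s * snd \<psi> s) + b * (snd z s * snd \<psi> s))
      = a * (LINT s|lebesgue_on {- T..0}. snd x s * snd \<psi> s) + b * (LINT s|lebesgue_on {- T..0}. snd z s * snd \<psi> s)"
    using assms i by (subst Bochner_Integration.integral_add) (auto simp: X_space_def)
  then show ?thesis
    by (simp add: X_inner_def X_comb_def algebra_simps)
qed

lemma X_inner_diff_right: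
  assumes "z \<in> X_space T" "L2 (- T) 0 f" "L2 (- T) 0 g"
  shows "X_inner T z (u - v, \<lambda>s. f s - g s) = X_inner T z (u, f) - X_inner T z (v, g)"
  using assms L2_mult_integrable[of "- T" 0 "snd z"]
  by (simp add: X_inner_def X_space_def algebra_simps)

lemma X_inner_scale_right: "X_inner T z (c * u, \<lambda>s. c * f s) = c * X_inner T z (u, f)"
proof -
  have "(LINT s|lebesgue_on {- T..0}. snd z s * (c * f s)) = (LINT s|lebesgue_on {- T..0}. c * (snd z s * f s))"
    by (intro Bochner_Integration.integral_cong) auto
  then show ?thesis by (simp add: X_inner_def algebra_simps)
qed

section \<open>The norm of the state space and continuity of pairings\<close>

lemma X_norm_power2: "(X_norm T z)\<^sup>2 = (fst z)\<^sup>2 + (LINT s|lebesgue_on {- T..0}. (snd z s)\<^sup>2)"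
  by (simp add: X_norm_def X_inner_def power2_eq_square)

lemma X_norm_nonneg: "X_norm T z \<ge> 0"
  by (simp add: X_norm_def X_inner_def)

lemma abs_fst_le_X_norm: "\<bar>fst z\<bar> \<le> X_norm T z"
proof -
  have "(fst z)\<^sup>2 \<le> (X_norm T z)\<^sup>2"
    by (simp add: X_norm_power2)
  then show ?thesis using X_norm_nonneg abs_le_square_iff[of "fst z" "X_norm T z"] by simp
qed

text \<open>Integrating \<open>\<bar>z\<bar> \<le> e + z\<^sup>2 / e\<close> gives the bound e T +
  N^2 / e with N the norm. The choice e = N produces the factor T + 1; for N = 0 the number e is
  sent to 0.\<close>

lemma L1_le_X_norm:
  assumes z: "z \<in> X_space T" and "T > 0"
  shows "(LINT s|lebesgue_on {- T..0}. \<bar>snd z s\<bar>) \<le> (T + 1) * X_norm T z"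
proof -
  let ?M = "lebesgue_on {- T..0}" and ?N = "X_norm T z"
  have L: "L2 (- T) 0 (snd z)" using z by (simp add: X_space_def)
  have i2: "integrable ?M (\<lambda>s. (snd z s)\<^sup>2)" using L by (simp add: L2_def)
  have i1: "integrable ?M (\<lambda>s. \<bar>snd z s\<bar>)" using L2_integrable[OF L] by simp
  have le: "(LINT s|?M. \<bar>snd z s\<bar>) \<le> e * T + ?N\<^sup>2 / e" if "e > 0" for e
  proof -
    have i0: "integrable ?M (\<lambda>s. e)"
      by (intro lebesgue_on_continuous_integral(1) continuous_on_const)
    have "(LINT s|?M. \<bar>snd z s\<bar>) \<le> (LINT s|?M. e + (snd z s)\<^sup>2 / e)"
    proof (rule integral_mono[OF i1])
      show "integrable ?M (\<lambda>s. e + (snd z s)\<^sup>2 / e)" using i0 i2 by simp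
      fix s
      have "2 * (e * \<bar>snd z s\<bar>) \<le> e\<^sup>2 + (snd z s)\<^sup>2"
        using sum_squares_bound[of e "\<bar>snd z s\<bar>"] by simp
      moreover have "0 \<le> e * \<bar>snd z s\<bar>" using that by simp
      ultimately have "e * \<bar>snd z s\<bar> \<le> e\<^sup>2 + (snd z s)\<^sup>2" by linarith
      then show "\<bar>snd z s\<bar> \<le> e + (snd z s)\<^sup>2 / e"
        using that by (simp add: field_simps power2_eq_square)
    qed
    also have "\<dots> = (LINT s|?M. e) + (LINT s|?M. (snd z s)\<^sup>2) / e"
      using i0 i2 by (subst Bochner_Integration.integral_add) auto
    also have "\<dots> \<le> e * T + ?N\<^sup>2 / e"
      using that \<open>T > 0\<close> lebesgue_on_continuous_integral(2)[of "- T" 0 "\<lambda>_. e"]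
      by (intro add_mono divide_right_mono) (auto simp: X_norm_power2 continuous_on_const)
    finally show ?thesis .
  qed
  show ?thesis
  proof (cases "?N = 0")
    case True
    have "(LINT s|?M. \<bar>snd z s\<bar>) \<le> 0 + r" if "r > 0" for r
      using le[of "r / T"] that True \<open>T > 0\<close> by simp
    then have "(LINT s|?M. \<bar>snd z s\<bar>) \<le> 0" by (rule field_le_epsilon)
    then show ?thesis using True by simp
  next
    case False
    then have "?N > 0" using X_norm_nonneg[of T z] by simp
    from le[OF this] this show ?thesis by (simp add: power2_eq_square algebra_simps)
  qed
qed

lemma abs_X_inner_le:
  assumes z: "z \<in> X_space T" and "T > 0" and \<phi>: "L2 (- T) 0 \<phi>"
    and B: "\<And>s. - T \<le> s \<Longrightarrow> s \<le> 0 \<Longrightarrow> \<bar>\<phi> s\<bar> \<le> B"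
  shows "\<bar>X_inner T z (u, \<phi>)\<bar> \<le> (\<bar>u\<bar> + B * (T + 1)) * X_norm T z"
proof -
  let ?M = "lebesgue_on {- T..0}"
  have B0: "B \<ge> 0" using B[of 0] \<open>T > 0\<close> by force
  have L: "L2 (- T) 0 (snd z)" using z by (simp add: X_space_def)
  have "\<bar>LINT s|?M. snd z s * \<phi> s\<bar> \<le> (LINT s|?M. \<bar>snd z s * \<phi> s\<bar>)"
    by (rule integral_abs_bound)
  also have "\<dots> \<le> (LINT s|?M. B * \<bar>snd z s\<bar>)"
  proof (rule integral_mono)
    show "integrable ?M (\<lambda>s. \<bar>snd z s * \<phi> s\<bar>)"
      using L2_mult_integrable[OF L \<phi>] by (rule integrable_abs)
    show "integrable ?M (\<lambda>s. B * \<bar>snd z s\<bar>)" using L2_integrable[OF L] by simp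
    show "\<bar>snd z s * \<phi> s\<bar> \<le> B * \<bar>snd z s\<bar>" if "s \<in> space ?M" for s
      using B[of s] that by (simp add: abs_mult mult.commute mult_right_mono)
  qed
  also have "\<dots> \<le> B * ((T + 1) * X_norm T z)"
    using L1_le_X_norm[OF z \<open>T > 0\<close>] B0 by (auto intro!: mult_left_mono)
  finally have 1: "\<bar>LINT s|?M. snd z s * \<phi> s\<bar> \<le> B * ((T + 1) * X_norm T z)" .
  have 2: "\<bar>fst z * u\<bar> \<le> \<bar>u\<bar> * X_norm T z"
    using abs_fst_le_X_norm[of z T] by (simp add: abs_mult mult.commute mult_left_mono)
  have "\<bar>X_inner T z (u, \<phi>)\<bar> \<le> \<bar>fst z * u\<bar> + \<bar>LINT s|?M. snd z s * \<phi> s\<bar>"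
    by (simp add: X_inner_def)
  with 1 2 show ?thesis by (simp add: algebra_simps)
qed

text \<open>Pairing with a fixed bounded function is Lipschitz for \<open>X_norm\<close>, so norm
  continuity of the curve passes to the scalar function.\<close>

lemma continuous_on_X_inner:
  assumes y: "X_continuous_on T S y" and "T > 0" and \<phi>: "continuous_on {- T..0} \<phi>"
  shows "continuous_on S (\<lambda>t. X_inner T (y t) (u, \<phi>))"
  unfolding continuous_on_def
proof
  fix t assume t: "t \<in> S"
  have ys: "y s \<in> X_space T" if "s \<in> S" for s using y that by (simp add: X_continuous_on_def)
  obtain B where B: "\<And>s. - T \<le> s \<Longrightarrow> s \<le> 0 \<Longrightarrow> \<bar>\<phi> s\<bar> \<le> B"
    using compact_imp_bounded[OF compact_continuous_image[OF \<phi> compact_Icc]]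
    unfolding bounded_iff by (metis atLeastAtMost_iff imageI real_norm_def)
  let ?d = "\<lambda>s. X_comb 1 (y s) (- 1) (y t)"
  have L: "L2 (- T) 0 \<phi>" by (rule L2_continuous[OF \<phi>])
  have "((\<lambda>s. X_inner T (y s) (u, \<phi>) - X_inner T (y t) (u, \<phi>)) \<longlongrightarrow> 0) (at t within S)"
  proof (rule Lim_null_comparison)
    show "\<forall>\<^sub>F s in at t within S. norm (X_inner T (y s) (u, \<phi>) - X_inner T (y t) (u, \<phi>))
        \<le> (\<bar>u\<bar> + B * (T + 1)) * X_norm T (?d s)"
      unfolding eventually_at_filter
    proof (intro always_eventually allI impI)
      fix s assume s: "s \<in> S"
      have "X_inner T (?d s) (u, \<phi>) = X_inner T (y s) (u, \<phi>) - X_inner T (y t) (u, \<phi>)"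
        using X_inner_comb_left[OF ys[OF s] ys[OF t], of "(u, \<phi>)" 1 "- 1"] L by (simp add: X_space_def)
      then show "norm (X_inner T (y s) (u, \<phi>) - X_inner T (y t) (u, \<phi>))
        \<le> (\<bar>u\<bar> + B * (T + 1)) * X_norm T (?d s)"
        using abs_X_inner_le[OF X_space_comb[where a = 1 and b = "- 1", OF ys[OF s] ys[OF t]] \<open>T > 0\<close> L B, of u]
        by simp
    qed
    have "((\<lambda>s. X_norm T (?d s)) \<longlongrightarrow> 0) (at t within S)"
      using y t by (simp add: X_continuous_on_def)
    then show "((\<lambda>s. (\<bar>u\<bar> + B * (T + 1)) * X_norm T (?d s)) \<longlongrightarrow> 0) (at t within S)"
      by (rule tendsto_mult_right_zero)
  qed
  then show "((\<lambda>s. X_inner T (y s) (u, \<phi>)) \<longlongrightarrow> X_inner T (y t) (u, \<phi>)) (at t within S)"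
    by (simp add: LIM_zero_iff)
qed

lemma weak_deriv_cong_AE:
  assumes "weak_deriv a b F d" "AE s in lebesgue_on {a..b}. d s = d' s"
    and "d \<in> borel_measurable (lebesgue_on {a..b})" "d' \<in> borel_measurable (lebesgue_on {a..b})"
  shows "weak_deriv a b F d'"
  unfolding weak_deriv_def
proof (intro allI impI)
  fix \<theta> assume t: "test_function a b \<theta>"
  have "\<theta> \<in> borel_measurable (lebesgue_on {a..b})"
    using lebesgue_on_continuous_integral(1)[OF test_functionD(3)[OF t]] by simp
  then have "(LINT s|lebesgue_on {a..b}. d s * \<theta> s) = (LINT s|lebesgue_on {a..b}. d' s * \<theta> s)"
    using assms(2-4) by (intro integral_cong_AE borel_measurable_times) (auto elim: eventually_mono)
  then show "(LINT s|lebesgue_on {a..b}. F s * deriv \<theta> s) = - (LINT s|lebesgue_on {a..b}. d' s * \<theta> s)"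
    using assms(1) t unfolding weak_deriv_def by auto
qed

text \<open>No sign or upper bound is imposed on the control, so that arbitrary admissible pairs and
  the closed-loop pair are both instances. Sign conditions enter as hypotheses of individual
  lemmas.\<close>

locale trajectory =
  fixes T :: real and x :: state and i :: "real \<Rightarrow> real" and y :: "real \<Rightarrow> state"
  assumes T_pos: "T > 0"
    and sol: "state_solution T x i y"
    and control_L2: "\<And>\<tau>. \<tau> > 0 \<Longrightarrow> L2 0 \<tau> i"
begin

lemma X_cont: "\<tau> > 0 \<Longrightarrow> X_continuous_on T {0..\<tau>} y"
  using sol by (simp add: state_solution_def)

lemma X_mem: "t \<ge> 0 \<Longrightarrow> y t \<in> X_space T"
  using X_cont[of "t + 1"] by (simp add: X_continuous_on_def)

lemma continuous_inner:
  assumes "continuous_on {- T..0} \<phi>"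
  shows "continuous_on {0..\<tau>} (\<lambda>t. X_inner T (y t) (u, \<phi>))"
proof -
  \<comment> \<open>Continuity in the norm is given on horizons of positive length only, hence the
    enlarged interval.\<close>
  have "continuous_on {0..max 1 \<tau>} (\<lambda>t. X_inner T (y t) (u, \<phi>))"
    by (intro continuous_on_X_inner X_cont T_pos assms) simp
  then show ?thesis by (rule continuous_on_subset) auto
qed

lemma rhs_integrable:
  assumes "continuous_on {- T..0} \<phi>'" "\<tau> > 0"
  shows "integrable (lebesgue_on {0..\<tau>}) (\<lambda>t. X_inner T (y t) (u, \<phi>') + i t * c)"
  using lebesgue_on_continuous_integral(1)[OF continuous_inner[OF assms(1)]]
    L2_integrable[OF control_L2[OF assms(2)]] by simp

text \<open>Evaluate the identity in the dual space at the domain element (\<phi>(0), \<phi>): the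
  adjoint of the generator contributes the pairing with \<phi>', the adjoint of the control operator
  the boundary difference of \<phi>.\<close>

lemma weak_equation:
  assumes D: "\<And>s. (\<phi> has_real_derivative \<phi>' s) (at s)" and c: "continuous_on UNIV \<phi>'" and "\<tau> > 0"
  shows "weak_deriv 0 \<tau> (\<lambda>t. X_inner T (y t) (\<phi> 0, \<phi>))
    (\<lambda>t. X_inner T (y t) (0, \<phi>') + i t * (\<phi> 0 - \<phi> (- T)))"
proof -
  let ?\<psi> = "(\<phi> 0, \<phi>)"
  have dom: "?\<psi> \<in> domA T" by (rule domA_C1[OF D c T_pos])
  obtain d where d: "L2_dual T \<tau> d" "dual_deriv T \<tau> y d"
    and eq: "AE t in lebesgue_on {0..\<tau>}. \<forall>\<psi>\<in>domA T. d t \<psi> = adjA T (y t) \<psi> + adjB T (i t) \<psi>"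
    using sol \<open>\<tau> > 0\<close> unfolding state_solution_def by blast
  show ?thesis
  proof (rule weak_deriv_cong_AE)
    show "weak_deriv 0 \<tau> (\<lambda>t. X_inner T (y t) ?\<psi>) (\<lambda>t. d t ?\<psi>)"
      using d dom unfolding dual_deriv_def by blast
    show "(\<lambda>t. d t ?\<psi>) \<in> borel_measurable (lebesgue_on {0..\<tau>})"
      using d dom unfolding L2_dual_def by blast
    show "(\<lambda>t. X_inner T (y t) (0, \<phi>') + i t * (\<phi> 0 - \<phi> (- T))) \<in> borel_measurable (lebesgue_on {0..\<tau>})"
      using rhs_integrable[OF continuous_on_subset[OF c] \<open>\<tau> > 0\<close>] by auto
    have "AE t in lebesgue_on {0..\<tau>}. t \<in> {0..\<tau>}" by (rule AE_I2) simp
    with eq show "AE t in lebesgue_on {0..\<tau>}. d t ?\<psi> = X_inner T (y t) (0, \<phi>') + i t * (\<phi> 0 - \<phi> (- T))"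
    proof eventually_elim
      case (elim t)
      then have "y t \<in> X_space T" using X_mem by simp
      then show ?case
        using elim dom X_inner_opA_C1[OF D c T_pos] by (simp add: adjA_def adjB_def opB_def)
    qed
  qed
qed

lemma integrated_equation:
  assumes D: "\<And>s. (\<phi> has_real_derivative \<phi>' s) (at s)" and c: "continuous_on UNIV \<phi>'"
    and "0 \<le> a" "a \<le> b"
  shows "((\<lambda>t. X_inner T (y t) (0, \<phi>') + i t * (\<phi> 0 - \<phi> (- T)))
    has_integral X_inner T (y b) (\<phi> 0, \<phi>) - X_inner T (y a) (\<phi> 0, \<phi>)) {a..b}"
proof -
  have c\<phi>: "continuous_on {- T..0} \<phi>"
    using D DERIV_isCont continuous_at_imp_continuous_on by blast
  \<comment> \<open>The weak equation is used on [0, b + 1], which has positive length even for b =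
    0.\<close>
  have "b + 1 > 0" using assms by simp
  then show ?thesis
    using weak_equation[OF D c] rhs_integrable[OF continuous_on_subset[OF c]] assms
    by (intro weak_deriv_has_integral[where a = 0 and b = "b + 1"] continuous_inner c\<phi>) auto
qed

end

section \<open>Sign of the history and of the exponential functional\<close>

text \<open>Replacing \<open>g\<close> by the maximum of \<open>f\<close> and \<open>g\<close>
  changes it on a null set only and makes the inequality hold everywhere.\<close>

lemma has_integral_le_AE:
  fixes f g :: "real \<Rightarrow> real"
  assumes f: "(f has_integral I) {a..b}" and g: "(g has_integral J) {a..b}"
    and le: "AE s in lebesgue_on {a..b}. f s \<le> g s"
  shows "I \<le> J"
proof -
  have "AE s in lebesgue. s \<in> {a..b} \<longrightarrow> f s \<le> g s"
    using le by (subst (asm) AE_restrict_space_iff) auto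
  then obtain N where N: "negligible N" "{s. \<not> (s \<in> {a..b} \<longrightarrow> f s \<le> g s)} \<subseteq> N"
    by (auto simp: eventually_ae_filter negligible_iff_null_sets)
  have "((\<lambda>s. max (f s) (g s)) has_integral J) {a..b}"
    by (rule has_integral_spike[OF N(1) _ g]) (use N(2) in \<open>auto simp: max_def\<close>)
  then show ?thesis by (rule has_integral_le[OF f]) simp
qed

lemma AE_lebesgue_on_subset:
  assumes "AE s in lebesgue_on S. P s" "U \<subseteq> S" "S \<in> sets lebesgue" "U \<in> sets lebesgue"
  shows "AE s in lebesgue_on U. P s"
proof -
  have "AE s in lebesgue. s \<in> S \<longrightarrow> P s"
    using assms by (subst (asm) AE_restrict_space_iff) auto
  then have "AE s in lebesgue. s \<in> U \<longrightarrow> P s"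
    by eventually_elim (use assms in auto)
  then show ?thesis using assms by (subst AE_restrict_space_iff) auto
qed

text \<open>The mean value theorem turns the remainder into an increment of \<open>f'\<close>, which
  is uniformly continuous on the compact interval.\<close>

lemma C1_linearization_uniform:
  fixes f f' :: "real \<Rightarrow> real"
  assumes D: "\<And>s. (f has_real_derivative f' s) (at s)" and c: "continuous_on UNIV f'" and "\<eta> > 0"
  obtains \<delta> where "\<delta> > 0"
    "\<And>p q. p \<in> {a..b} \<Longrightarrow> q \<in> {a..b} \<Longrightarrow> \<bar>q - p\<bar> < \<delta> \<Longrightarrow> \<bar>f q - f p - (q - p) * f' p\<bar> \<le> \<eta> * \<bar>q - p\<bar>"
proof -
  have "uniformly_continuous_on {a..b} f'"
    by (intro compact_uniformly_continuous continuous_on_subset[OF c]) auto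
  then obtain \<delta> where \<delta>: "\<delta> > 0"
    "\<And>p q. p \<in> {a..b} \<Longrightarrow> q \<in> {a..b} \<Longrightarrow> \<bar>q - p\<bar> < \<delta> \<Longrightarrow> \<bar>f' q - f' p\<bar> < \<eta>"
    using \<open>\<eta> > 0\<close> unfolding uniformly_continuous_on_def dist_real_def by metis
  have "\<bar>f q - f p - (q - p) * f' p\<bar> \<le> \<eta> * \<bar>q - p\<bar>"
    if pq: "p \<in> {a..b}" "q \<in> {a..b}" "\<bar>q - p\<bar> < \<delta>" for p q
  proof -
    obtain z where z: "z \<in> {a..b}" "\<bar>z - p\<bar> < \<delta>" "f q - f p = (q - p) * f' z"
    proof (cases q p rule: linorder_cases)
      case less
      from MVT2[OF less D] obtain z where "q < z" "z < p" "f p - f q = (p - q) * f' z" by blast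
      then show ?thesis using that[of z] pq by (auto simp: algebra_simps)
    next
      case equal
      then show ?thesis using that[of p] pq by simp
    next
      case greater
      from MVT2[OF greater D] obtain z where "p < z" "z < q" "f q - f p = (q - p) * f' z" by blast
      then show ?thesis using that[of z] pq by auto
    qed
    have "\<bar>f q - f p - (q - p) * f' p\<bar> = \<bar>f' z - f' p\<bar> * \<bar>q - p\<bar>"
      unfolding z(3) by (simp add: abs_mult flip: right_diff_distrib)
    also have "\<dots> \<le> \<eta> * \<bar>q - p\<bar>"
      using \<delta>(2)[OF pq(1) z(1,2)] by (intro mult_right_mono) auto
    finally show ?thesis .
  qed
  with \<delta>(1) show ?thesis by (rule that)
qed

section \<open>Transport along trajectories and the sign of the exponential functional\<close>

context trajectory
begin

text \<open>The pairing of \<open>y t\<close> with the backward translate \<open>f (\<cdot> + (t1 - t))\<close> is nonincreasing in \<open>t\<close>: the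
  translation cancels the transport term and only the boundary term \<open>- i f \<le> 0\<close> remains. Since
  \<open>i\<close> is merely square-integrable, this is not done by differentiating: the increments are
  bounded by \<open>\<epsilon> (b - a)\<close> locally, and Bolzano's bisection makes the bound global.\<close>

lemma transported_pairing_nonpos:
  assumes i_nonneg: "AE t in lebesgue_on {0..}. 0 \<le> i t"
    and x_nonpos: "AE s in lebesgue_on {- T..0}. snd x s \<le> 0"
    and D: "\<And>s. (f has_real_derivative f' s) (at s)" and c: "continuous_on UNIV f'"
    and f_nonneg: "\<And>s. f s \<ge> 0" and f_0: "\<And>s. s \<ge> 0 \<Longrightarrow> f s = 0" and t1: "t1 \<ge> 0"
  shows "X_inner T (y t1) (0, f) \<le> 0"
proof -
  \<comment> \<open>At time \<open>t1\<close> this is the pairing in the claim; at time 0 it pairs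
    the initial history with a nonnegative function, hence is nonpositive.\<close>
  define \<gamma> where "\<gamma> t = X_inner T (y t) (0, \<lambda>s. f (s + (t1 - t)))" for t
  have Dsh: "((\<lambda>s. f (s + h)) has_real_derivative f' (s + h)) (at s)" for s h
  proof -
    have "((\<lambda>s. s + h) has_real_derivative 1) (at s)" by (auto intro!: derivative_eq_intros)
    from DERIV_chain2[OF D this] show ?thesis by simp
  qed
  have csh: "continuous_on S (\<lambda>s. f' (s + h))" for h S
    by (intro continuous_on_compose2[OF c] continuous_intros) auto
  have csf: "continuous_on S (\<lambda>s. f (s + h))" for h S
    using Dsh DERIV_isCont continuous_at_imp_continuous_on by blast
  have step: "\<gamma> t1 - \<gamma> 0 \<le> \<epsilon> * (t1 - 0)" if "\<epsilon> > 0" for \<epsilon>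
  proof -
    \<comment> \<open>The increment bound is additive over adjacent intervals, so a bound near every
      point suffices. The two guards discard intervals that stick out of [0, t1].\<close>
    define Q where "Q a b \<longleftrightarrow> (0 \<le> a \<longrightarrow> b \<le> t1 \<longrightarrow> \<gamma> b - \<gamma> a \<le> \<epsilon> * (b - a))" for a b
    have "Q 0 t1"
      using t1
    proof (induction rule: Bolzano)
      case (trans a b c)
      then show ?case by (auto simp: Q_def algebra_simps)
    next
      case (local t)
      \<comment> \<open>Near \<open>t\<close> the norm of the state is at most that at
        \<open>t\<close> plus 1, so \<open>K\<close> bounds the pairing with any function of sup
        norm at most 1. In \<eta> the summand 2 pays for replacing \<open>R\<close> by
        \<open>R t\<close> twice: in the integrated equation and in the first-order terms.\<close>
      define K where "K = (T + 1) * (X_norm T (y t) + 1)"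
      define \<eta> where "\<eta> = \<epsilon> / (2 + K)"
      have K: "K \<ge> 0" using T_pos X_norm_nonneg by (simp add: K_def)
      have \<eta>: "\<eta> > 0" "\<eta> * (2 + K) = \<epsilon>" using K \<open>\<epsilon> > 0\<close> by (simp_all add: \<eta>_def)
      define F where "F = (\<lambda>s. f (s + (t1 - t)))"
      define F' where "F' = (\<lambda>s. f' (s + (t1 - t)))"
      \<comment> \<open>\<open>E\<close> pairs the moving state with the translate frozen at time
        \<open>t\<close>, \<open>R\<close> with its derivative. To first order \<gamma>(r) is E(r) +
        (t - r) R(r), and the increments of \<open>E\<close> come from the state equation.\<close>
      define R where "R = (\<lambda>r. X_inner T (y r) (0, F'))"
      define E where "E = (\<lambda>r. X_inner T (y r) (0, F))"
      have cR: "continuous_on {0..t1} R"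
        unfolding R_def F'_def by (intro continuous_inner csh)
      have t: "t \<in> {0..t1}" using local by simp
      obtain d1 where d1: "d1 > 0" "\<And>r. r \<in> {0..t1} \<Longrightarrow> \<bar>r - t\<bar> < d1 \<Longrightarrow> \<bar>R r - R t\<bar> < \<eta>"
        using cR t \<eta>(1) unfolding continuous_on_iff dist_real_def by metis
      obtain d2 where d2: "d2 > 0" "\<And>p q. p \<in> {- T..t1} \<Longrightarrow> q \<in> {- T..t1} \<Longrightarrow> \<bar>q - p\<bar> < d2
          \<Longrightarrow> \<bar>f q - f p - (q - p) * f' p\<bar> \<le> \<eta> * \<bar>q - p\<bar>"
        using C1_linearization_uniform[OF D c \<eta>(1), of "- T" t1] by metis
      let ?d = "\<lambda>r. X_comb 1 (y r) (- 1) (y t)"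
      obtain d3 where d3: "d3 > 0" "\<And>r. r \<in> {0..t1} \<Longrightarrow> \<bar>r - t\<bar> < d3 \<Longrightarrow> r \<noteq> t \<Longrightarrow> X_norm T (?d r) < 1"
      proof -
        have "((\<lambda>r. X_norm T (?d r)) \<longlongrightarrow> 0) (at t within {0..t1 + 1})"
          using X_cont[of "t1 + 1"] t t1 by (simp add: X_continuous_on_def)
        from order_tendstoD(2)[OF this, of 1] show ?thesis
          using that unfolding eventually_at dist_real_def by force
      qed
      \<comment> \<open>The linearization of the translate is uniform in the space variable, so its
        remainder \<open>g\<close> has sup norm at most \<eta> times the time difference. The state
        is split into its value at \<open>t\<close> and a difference of norm below 1.\<close>
      have approx: "\<bar>\<gamma> r - E r - (t - r) * R r\<bar> \<le> K * \<eta> * \<bar>t - r\<bar>"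
        if r: "r \<in> {0..t1}" "\<bar>r - t\<bar> < d2" "\<bar>r - t\<bar> < d3" for r
      proof (cases "r = t")
        case True
        then show ?thesis by (simp add: \<gamma>_def E_def F_def)
      next
        case False
        define g where "g = (\<lambda>s. f (s + (t1 - r)) - F s - (t - r) * F' s)"
        have Lg: "L2 (- T) 0 g"
          unfolding g_def F_def F'_def by (intro L2_continuous continuous_intros csf csh)
        have g_le: "\<bar>g s\<bar> \<le> \<eta> * \<bar>t - r\<bar>" if "- T \<le> s" "s \<le> 0" for s
          using d2(2)[of "s + (t1 - t)" "s + (t1 - r)"] that r t by (simp add: g_def F_def F'_def abs_minus_commute)
        have yr: "y r \<in> X_space T" and yt: "y t \<in> X_space T" using r t X_mem by auto
        have L: "L2 (- T) 0 (\<lambda>s. f (s + (t1 - r)))" "L2 (- T) 0 F" "L2 (- T) 0 (\<lambda>s. (t - r) * F' s)"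
          "L2 (- T) 0 (\<lambda>s. f (s + (t1 - r)) - F s)"
          unfolding F_def F'_def by (intro L2_continuous continuous_intros csf csh)+
        have "X_inner T (y r) (0 - 0 - (t - r) * 0, g) = \<gamma> r - E r - (t - r) * R r"
          unfolding g_def \<gamma>_def E_def R_def X_inner_diff_right[OF yr L(4,3)] X_inner_diff_right[OF yr L(1,2)]
            X_inner_scale_right ..
        then have eq: "\<gamma> r - E r - (t - r) * R r = X_inner T (y r) (0, g)" by simp
        have "X_inner T (?d r) (0, g) = X_inner T (y r) (0, g) - X_inner T (y t) (0, g)"
          using X_inner_comb_left[OF yr yt, of "(0, g)" 1 "- 1"] Lg by (simp add: X_space_def)
        moreover have "\<bar>X_inner T (?d r) (0, g)\<bar> \<le> \<eta> * \<bar>t - r\<bar> * (T + 1) * 1"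
        proof -
          have "\<bar>X_inner T (?d r) (0, g)\<bar> \<le> (\<bar>0\<bar> + \<eta> * \<bar>t - r\<bar> * (T + 1)) * X_norm T (?d r)"
            by (rule abs_X_inner_le[OF X_space_comb[OF yr yt] T_pos Lg g_le])
          also have "\<dots> \<le> (\<bar>0\<bar> + \<eta> * \<bar>t - r\<bar> * (T + 1)) * 1"
            using d3(2)[OF r(1,3) False] \<eta>(1) T_pos by (intro mult_left_mono) auto
          finally show ?thesis by simp
        qed
        moreover have "\<bar>X_inner T (y t) (0, g)\<bar> \<le> \<eta> * \<bar>t - r\<bar> * (T + 1) * X_norm T (y t)"
          using abs_X_inner_le[OF yt T_pos Lg g_le, of 0] by simp
        ultimately have "\<bar>X_inner T (y r) (0, g)\<bar>
            \<le> \<eta> * \<bar>t - r\<bar> * (T + 1) * 1 + \<eta> * \<bar>t - r\<bar> * (T + 1) * X_norm T (y t)" by linarith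
        then show ?thesis unfolding eq by (simp add: K_def algebra_simps)
      qed
      have "\<gamma> b - \<gamma> a \<le> \<epsilon> * (b - a)"
        if ab: "a \<le> t" "t \<le> b" "b - a < min d1 (min d2 d3)" "0 \<le> a" "b \<le> t1" for a b
      proof -
        have DF: "(F has_real_derivative F' s) (at s)" for s unfolding F_def F'_def by (rule Dsh)
        have "((\<lambda>r. R r + i r * (F 0 - F (- T))) has_integral E b - E a) {a..b}"
          using integrated_equation[OF DF, of a b] ab csh[of UNIV "t1 - t"] f_0[of "t1 - t"]
          by (auto simp: F_def F'_def E_def R_def)
        moreover have "((\<lambda>r. R t + \<eta>) has_integral (b - a) * (R t + \<eta>)) {a..b}"
          using has_integral_const_real[of "R t + \<eta>" a b] ab by simp
        \<comment> \<open>Since \<open>f\<close> vanishes on the nonnegative axis,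
          \<open>F 0 = 0\<close>; with \<open>i\<close> and \<open>F\<close> nonnegative the
          boundary term can only lower the rate.\<close>
        moreover have "AE r in lebesgue_on {a..b}. R r + i r * (F 0 - F (- T)) \<le> R t + \<eta>"
        proof -
          have "AE r in lebesgue_on {a..b}. 0 \<le> i r"
            using ab by (intro AE_lebesgue_on_subset[OF i_nonneg]) auto
          moreover have "AE r in lebesgue_on {a..b}. r \<in> {a..b}" by (rule AE_I2) simp
          ultimately show ?thesis
          proof eventually_elim
            case (elim r)
            have "F 0 = 0" "F (- T) \<ge> 0" using f_0[of "t1 - t"] f_nonneg t by (auto simp: F_def)
            then have "i r * (F 0 - F (- T)) \<le> 0" using elim by (simp add: mult_nonneg_nonneg)
            moreover have "\<bar>R r - R t\<bar> < \<eta>" using elim ab by (intro d1) auto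
            ultimately show ?case by linarith
          qed
        qed
        ultimately have e1: "E b - E a \<le> (b - a) * (R t + \<eta>)" by (rule has_integral_le_AE)
        have "\<bar>\<gamma> b - E b - (t - b) * R b\<bar> \<le> K * \<eta> * \<bar>t - b\<bar>"
          using ab by (intro approx) auto
        then have e2: "\<gamma> b \<le> E b + (t - b) * R b + K * \<eta> * (b - t)"
          using ab by (auto simp: abs_if split: if_splits)
        have "\<bar>\<gamma> a - E a - (t - a) * R a\<bar> \<le> K * \<eta> * \<bar>t - a\<bar>"
          using ab by (intro approx) auto
        then have e3: "\<gamma> a \<ge> E a + (t - a) * R a - K * \<eta> * (t - a)"
          using ab by (auto simp: abs_if split: if_splits)
        \<comment> \<open>The main terms cancel: the state equation contributes (b - a) R(t), and
          the two translations remove (b - t) R(t) and (t - a) R(t).\<close>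
        have "(b - t) * (R t - \<eta>) \<le> (b - t) * R b"
          using d1(2)[of b] ab by (intro mult_left_mono) auto
        moreover have "(t - a) * (R t - \<eta>) \<le> (t - a) * R a"
          using d1(2)[of a] ab by (intro mult_left_mono) auto
        ultimately have "\<gamma> b - \<gamma> a \<le> (\<eta> * (2 + K)) * (b - a)"
          using e1 e2 e3 by (simp add: algebra_simps)
        then show ?thesis by (simp add: \<eta>(2))
      qed
      then show ?case
        using d1(1) d2(1) d3(1) unfolding Q_def by (intro exI[of _ "min d1 (min d2 d3)"]) auto
    qed
    then show ?thesis by (simp add: Q_def)
  qed
  have "\<gamma> t1 \<le> \<gamma> 0"
  proof (rule field_le_epsilon)
    fix e :: real assume "e > 0"
    \<comment> \<open>Dividing by t1 + 1 keeps the quotient meaningful when t1 = 0.\<close>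
    then have "\<gamma> t1 - \<gamma> 0 \<le> e / (t1 + 1) * (t1 - 0)" using t1 by (intro step) simp
    also have "\<dots> \<le> e" using t1 \<open>e > 0\<close> by (simp add: field_simps)
    finally show "\<gamma> t1 \<le> \<gamma> 0 + e" by simp
  qed
  also have "\<gamma> 0 \<le> 0"
  proof -
    have "AE s in lebesgue_on {- T..0}. snd (y 0) s = snd x s"
      using sol by (simp add: state_solution_def X_eq_def)
    with x_nonpos have "AE s in lebesgue_on {- T..0}. 0 \<le> - (snd (y 0) s * f (s + t1))"
      by eventually_elim (simp add: f_nonneg mult_nonpos_nonneg)
    then have "0 \<le> (LINT s|lebesgue_on {- T..0}. - (snd (y 0) s * f (s + t1)))"
      by (rule integral_nonneg_AE)
    then show ?thesis by (simp add: \<gamma>_def X_inner_def)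
  qed
  finally show ?thesis by (simp add: \<gamma>_def)
qed

text \<open>The function 1 - exp(r s) is positive for s < 0, and its positive part vanishes for s
  \<ge> 0. The previous lemma applies to smooth approximations of that positive part. The outcome
  compares the exponential functional with the pairing against the constant 1, which is
  conserved.\<close>

lemma exp_pairing_nonpos:
  assumes i_nonneg: "AE t in lebesgue_on {0..}. 0 \<le> i t"
    and x_nonpos: "AE s in lebesgue_on {- T..0}. snd x s \<le> 0"
    and r: "r > 0" and t: "t \<ge> 0"
  shows "X_inner T (y t) (0, \<lambda>s. 1 - exp (r * s)) \<le> 0"
proof (rule field_le_epsilon)
  fix e :: real assume e: "e > 0"
  define N where "N = (T + 1) * X_norm T (y t)"
  have N: "N \<ge> 0" using T_pos X_norm_nonneg by (simp add: N_def)
  define \<epsilon> where "\<epsilon> = e / (N + 1)"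
  have \<epsilon>: "\<epsilon> > 0" using N e by (simp add: \<epsilon>_def)
  define p where "p = (\<lambda>s. 1 - exp (r * s))"
  \<comment> \<open>The positive part of \<open>p\<close> has a corner at \<open>0\<close>; \<open>f\<close> is a continuously differentiable function within
      \<open>\<epsilon>\<close> of it.\<close>
  define f where "f = (\<lambda>s. ((max 0 (p s))\<^sup>2 - (max 0 (p s - \<epsilon>))\<^sup>2) / (2 * \<epsilon>))"
  define f' where "f' = (\<lambda>s. (2 * max 0 (p s) * (- (r * exp (r * s)))
    - 2 * max 0 (p s - \<epsilon>) * (- (r * exp (r * s)))) / (2 * \<epsilon>))"
  have Dp: "((\<lambda>s. p s - k) has_real_derivative - (r * exp (r * s))) (at s)" for s k
    unfolding p_def by (auto intro!: derivative_eq_intros)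
  have D: "(f has_real_derivative f' s) (at s)" for s
    unfolding f_def f'_def
    by (intro DERIV_cdivide DERIV_diff DERIV_chain2[OF DERIV_max_0_square]
        Dp Dp[of 0, simplified])
  have c: "continuous_on UNIV f'"
    unfolding f'_def p_def using \<epsilon> by (intro continuous_intros) auto
  have "X_inner T (y t) (0, f) \<le> 0"
  proof (rule transported_pairing_nonpos[OF i_nonneg x_nonpos D c _ _ t])
    show "f s \<ge> 0" for s
      unfolding f_def using \<epsilon> by (intro divide_nonneg_pos) (auto intro!: power_mono)
    show "f s = 0" if "s \<ge> 0" for s
    proof -
      have "p s \<le> 0" using that r by (simp add: p_def)
      then show ?thesis using \<epsilon> by (simp add: f_def)
    qed
  qed
  moreover have cf: "continuous_on {- T..0} f" and cp: "continuous_on {- T..0} p"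
    using D DERIV_isCont continuous_at_imp_continuous_on by (blast, auto simp: p_def intro!: continuous_intros)
  moreover have "\<bar>X_inner T (y t) (0, \<lambda>s. p s - f s)\<bar> \<le> (\<bar>0\<bar> + \<epsilon> * (T + 1)) * X_norm T (y t)"
  proof (rule abs_X_inner_le[OF X_mem[OF t] T_pos])
    show "L2 (- T) 0 (\<lambda>s. p s - f s)" by (intro L2_continuous continuous_intros cf cp)
    fix s assume "s \<le> (0::real)"
    then have p0: "p s \<ge> 0" using r by (simp add: p_def mult_nonneg_nonpos)
    show "\<bar>p s - f s\<bar> \<le> \<epsilon>"
    \<comment> \<open>As a function of the level p \<ge> 0, \<open>f\<close> is p^2 / (2 \<epsilon>)
      up to level \<epsilon> and p - \<epsilon> / 2 above it.\<close>
    proof (cases "p s \<le> \<epsilon>")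
      case True
      have "f s = p s * (p s / (2 * \<epsilon>))" using True p0 by (simp add: f_def power2_eq_square)
      moreover have "p s / (2 * \<epsilon>) \<le> 1" using True \<epsilon> by simp
      ultimately have "0 \<le> f s" "f s \<le> p s"
        using p0 \<epsilon> mult_left_mono[of "p s / (2 * \<epsilon>)" 1 "p s"] by simp_all
      then show ?thesis using True by simp
    next
      case False
      then have "f s = p s - \<epsilon> / 2" using p0 \<epsilon> by (simp add: f_def power2_eq_square field_simps)
      then show ?thesis using \<epsilon> by simp
    qed
  qed
  moreover have "X_inner T (y t) (0 - 0, \<lambda>s. p s - f s) = X_inner T (y t) (0, p) - X_inner T (y t) (0, f)"
    by (intro X_inner_diff_right X_mem t L2_continuous cf cp)
  ultimately have "X_inner T (y t) (0, p) \<le> \<epsilon> * N" by (simp add: N_def)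
  also have "\<dots> \<le> e" using N e by (simp add: \<epsilon>_def field_simps)
  finally show "X_inner T (y t) (0, \<lambda>s. 1 - exp (r * s)) \<le> 0 + e" by (simp add: p_def)
qed

text \<open>The weak equation is tested with exp(r s), an eigenfunction of differentiation. The root
  equation turns the boundary difference 1 - exp(- r T) into r / A, so that state and control
  combine into consumption, and the factor exp(- r t) absorbs the growth at rate r.\<close>

lemma discounted_equation:
  assumes A: "A > 0" and r: "r > 0" and root: "r = A * (1 - exp (- r * T))" and ab: "0 \<le> a" "a \<le> b"
  shows "((\<lambda>t. exp (- r * t) * (A * fst (y t) - i t)) has_integral
    A / r * (exp (- r * a) * X_inner T (y a) (1, \<lambda>s. exp (r * s))
      - exp (- r * b) * X_inner T (y b) (1, \<lambda>s. exp (r * s)))) {a..b}"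
proof -
  define G where "G = (\<lambda>t. X_inner T (y t) (1, \<lambda>s. exp (r * s)))"
  define d where "d = (\<lambda>t. X_inner T (y t) (0, \<lambda>s. r * exp (r * s)) + i t * (exp (r * 0) - exp (r * (- T))))"
  have D: "((\<lambda>s. exp (r * s)) has_real_derivative r * exp (r * s)) (at s)" for s
    by (auto intro!: derivative_eq_intros)
  have cD: "continuous_on S (\<lambda>s. r * exp (r * s))" for S by (intro continuous_intros)
  let ?t = "b + 1"
  have t: "?t > 0" using ab by simp
  have cG: "continuous_on {0..?t} G" unfolding G_def by (intro continuous_inner continuous_intros)
  have di: "integrable (lebesgue_on {0..?t}) d" unfolding d_def by (rule rhs_integrable[OF cD t])
  have "weak_deriv 0 ?t G d"
    using weak_equation[OF D cD t] by (simp add: G_def d_def)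
  from weak_deriv_exp_mult[OF this cG di, of "- r"]
  have w: "weak_deriv 0 ?t (\<lambda>s. exp (- r * s) * G s) (\<lambda>s. exp (- r * s) * (d s + - r * G s))" .
  \<comment> \<open>The transport term reproduces r times the history part of \<open>G\<close> only;
    subtracting r times all of \<open>G\<close> leaves - r times the first component.\<close>
  have eq: "exp (- r * s) * (d s + - r * G s) = - (r / A) * (exp (- r * s) * (A * fst (y s) - i s))" for s
  proof -
    have "X_inner T (y s) (r * 0, \<lambda>s. r * exp (r * s)) = r * X_inner T (y s) (0, \<lambda>s. exp (r * s))"
      by (rule X_inner_scale_right)
    moreover have "G s = fst (y s) + X_inner T (y s) (0, \<lambda>s. exp (r * s))"
      by (simp add: G_def X_inner_def)
    moreover have e: "exp (r * 0) - exp (r * (- T)) = r / A" using root A by (simp add: field_simps)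
    have "d s = X_inner T (y s) (0, \<lambda>s. r * exp (r * s)) + i s * (r / A)"
      unfolding d_def e ..
    ultimately have "d s + - r * G s = r / A * i s - r * fst (y s)"
      by (simp add: algebra_simps)
    also have "\<dots> = - (r / A) * (A * fst (y s) - i s)"
      using A by (simp add: field_simps)
    finally have "d s + - r * G s = - (r / A) * (A * fst (y s) - i s)" .
    then show ?thesis by simp
  qed
  have "integrable (lebesgue_on {0..?t}) (\<lambda>s. exp (- r * s) * (d s + - r * G s))"
  proof -
    have "L2 0 ?t (\<lambda>s. exp (- r * s))" "L2 0 ?t G" "L2 0 ?t i"
      and "L2 0 ?t (\<lambda>t. X_inner T (y t) (0, \<lambda>s. r * exp (r * s)))"
      using t by (auto intro!: L2_continuous cG control_L2 continuous_inner continuous_intros)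
    from L2_linear_combination[OF L2_linear_combination[OF this(4,3), of 1 "exp (r * 0) - exp (r * (- T))"] this(2), of 1 "- r"]
      this(1)
    show ?thesis by (intro L2_mult_integrable) (simp_all add: d_def mult.commute)
  qed
  moreover have "continuous_on {0..?t} (\<lambda>s. exp (- r * s) * G s)"
    by (intro continuous_intros cG)
  ultimately have "((\<lambda>s. - (r / A) * (exp (- r * s) * (A * fst (y s) - i s)))
      has_integral exp (- r * b) * G b - exp (- r * a) * G a) {a..b}"
    unfolding eq[symmetric] using w t ab by (intro weak_deriv_has_integral[OF w]) auto
  from has_integral_mult_right[OF this, of "- (A / r)"] show ?thesis
    using A r by (simp add: G_def algebra_simps)
qed

lemma exp_functional_nonneg:
  assumes A: "A > 0" and r: "r > 0" and root: "r = A * (1 - exp (- r * T))"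
    and adm: "AE t in lebesgue_on {0..}. 0 \<le> i t \<and> i t \<le> A * fst (y t)"
    and x_nonpos: "AE s in lebesgue_on {- T..0}. snd x s \<le> 0" and t: "t \<ge> 0"
  shows "X_inner T (y t) (1, \<lambda>s. exp (r * s)) \<ge> 0"
proof (rule ccontr)
  define G where "G = (\<lambda>t. X_inner T (y t) (1, \<lambda>s. exp (r * s)))"
  define K where "K = X_inner T (y 0) (1, \<lambda>_. 1)"
  assume "\<not> ?thesis"
  then have neg: "G t < 0" by (simp add: G_def)
  have i_nonneg: "AE t in lebesgue_on {0..}. 0 \<le> i t"
    using adm by eventually_elim simp
  \<comment> \<open>The constant function 1 has zero derivative and equal boundary values, so the
    pairing with it is conserved. Its excess over \<open>G\<close> is the nonpositive pairing with 1
    - exp(r s).\<close>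
  have lower: "G u \<ge> K" if u: "u \<ge> 0" for u
  proof -
    have "((\<lambda>t. X_inner T (y t) (0, \<lambda>_. 0) + i t * (1 - 1))
        has_integral X_inner T (y u) (1, \<lambda>_. 1) - X_inner T (y 0) (1, \<lambda>_. 1)) {0..u}"
      using integrated_equation[of "\<lambda>_. 1" "\<lambda>_. 0" 0 u] u by simp
    moreover have "X_inner T z (0, \<lambda>_. 0) = 0" for z by (simp add: X_inner_def)
    ultimately have "X_inner T (y u) (1, \<lambda>_. 1) = K"
      by (simp add: K_def has_integral_0_eq)
    moreover have "X_inner T (y u) (1 - 1, \<lambda>s. 1 - exp (r * s)) = X_inner T (y u) (1, \<lambda>_. 1) - G u"
      unfolding G_def by (intro X_inner_diff_right X_mem u L2_continuous continuous_intros)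
    ultimately show ?thesis using exp_pairing_nonpos[OF i_nonneg x_nonpos r u] by simp
  qed
  \<comment> \<open>Consumption is nonnegative, so the discounted functional is
    nonincreasing.\<close>
  have upper: "G u \<le> exp (r * (u - t)) * G t" if "u \<ge> t" for u
  proof -
    have "0 \<le> A / r * (exp (- r * t) * G t - exp (- r * u) * G u)"
    proof (rule has_integral_le_AE[OF has_integral_0])
      show "((\<lambda>t. exp (- r * t) * (A * fst (y t) - i t)) has_integral
          A / r * (exp (- r * t) * G t - exp (- r * u) * G u)) {t..u}"
        unfolding G_def by (rule discounted_equation[OF A r root t that])
      have "AE s in lebesgue_on {t..u}. 0 \<le> i s \<and> i s \<le> A * fst (y s)"
        using t by (intro AE_lebesgue_on_subset[OF adm]) auto
      then show "AE s in lebesgue_on {t..u}. 0 \<le> exp (- r * s) * (A * fst (y s) - i s)"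
        by eventually_elim simp
    qed
    then have "exp (- r * u) * G u \<le> exp (- r * t) * G t"
      using A r by (simp add: zero_le_mult_iff zero_le_divide_iff)
    then have "exp (r * u) * (exp (- r * u) * G u) \<le> exp (r * u) * (exp (- r * t) * G t)"
      by (rule mult_left_mono) simp
    then show ?thesis by (simp add: right_diff_distrib exp_diff exp_minus field_simps flip: exp_add)
  qed
  \<comment> \<open>At this time the estimate exp(z) \<ge> 1 + z already pushes the upper bound down
    to G(t) - |K|, below the lower bound.\<close>
  define u where "u = t + \<bar>K\<bar> / (r * \<bar>G t\<bar>)"
  have u: "u \<ge> t" using r by (simp add: u_def)
  have "1 + r * (u - t) \<le> exp (r * (u - t))" by (rule exp_ge_add_one_self)
  then have "exp (r * (u - t)) * G t \<le> (1 + r * (u - t)) * G t"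
    using neg by (intro mult_right_mono_neg) auto
  also have "\<dots> = G t - \<bar>K\<bar>" using neg r by (simp add: u_def field_simps)
  finally have "G u < - \<bar>K\<bar>" using upper[OF u] neg by simp
  moreover have "G u \<ge> K" using u t by (intro lower) simp
  ultimately show False by linarith
qed

end

section \<open>Discounted utility under a budget constraint\<close>

lemma borel_measurable_half_line:
  fixes f :: "real \<Rightarrow> real"
  assumes "\<And>\<tau>. \<tau> > 0 \<Longrightarrow> f \<in> borel_measurable (lebesgue_on {0..\<tau>})"
  shows "f \<in> borel_measurable (lebesgue_on {0..})"
proof (rule borel_measurable_if_D)
  let ?g = "\<lambda>n s. if s \<in> {0..real (Suc n)} then f s else 0"
  show "(\<lambda>s. if s \<in> {0..} then f s else 0) \<in> borel_measurable lebesgue"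
  proof (rule borel_measurable_LIMSEQ_real)
    show "?g n \<in> borel_measurable lebesgue" for n
      by (intro borel_measurable_if_I assms) auto
    fix s
    obtain N where "s \<le> real N" using real_arch_simple by blast
    then show "(\<lambda>n. ?g n s) \<longlonglongrightarrow> (if s \<in> {0..} then f s else 0)"
      by (intro tendsto_eventually eventually_sequentiallyI[of N]) auto
  qed
qed

text \<open>Monotone convergence along [0, n + 1] carries a bound valid on every finite horizon to
  the half-line.\<close>

lemma nn_integral_half_line_le:
  fixes f :: "real \<Rightarrow> real"
  assumes int: "\<And>\<tau>. \<tau> > 0 \<Longrightarrow> integrable (lebesgue_on {0..\<tau>}) f"
    and nonneg: "AE s in lebesgue_on {0..}. 0 \<le> f s"
    and le: "\<And>\<tau>. \<tau> > 0 \<Longrightarrow> (LINT s|lebesgue_on {0..\<tau>}. f s) \<le> W"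
  shows "(\<integral>\<^sup>+ s. ennreal (f s) \<partial>lebesgue_on {0..}) \<le> ennreal W"
proof -
  let ?M = "lebesgue_on {0::real..}" and ?I = "\<lambda>n. {0..real (Suc n)}"
  have mf: "f \<in> borel_measurable ?M"
    by (rule borel_measurable_half_line, rule borel_measurable_integrable, rule int)
  have "(\<integral>\<^sup>+ s. ennreal (f s) \<partial>?M) = (\<integral>\<^sup>+ s. (SUP n. ennreal (f s) * indicator (?I n) s) \<partial>?M)"
  proof (rule nn_integral_cong)
    fix s assume "s \<in> space ?M"
    then have "s \<ge> 0" by simp
    obtain N where "s \<le> real N" using real_arch_simple by blast
    then have "ennreal (f s) * indicator (?I N) s = ennreal (f s)" using \<open>s \<ge> 0\<close> by simp
    then show "ennreal (f s) = (SUP n. ennreal (f s) * indicator (?I n) s)"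
      by (intro antisym SUP_upper2[of N] SUP_least) (auto simp: indicator_def)
  qed
  also have "\<dots> = (SUP n. \<integral>\<^sup>+ s. ennreal (f s) * indicator (?I n) s \<partial>?M)"
  proof (rule nn_integral_monotone_convergence_SUP)
    show "incseq (\<lambda>n s. ennreal (f s) * indicator (?I n) s)"
      by (auto simp: incseq_def le_fun_def indicator_def)
    show "(\<lambda>s. ennreal (f s) * indicator (?I n) s) \<in> borel_measurable ?M" for n
      by (intro borel_measurable_times_ennreal measurable_compose[OF mf measurable_ennreal]
          measurable_restrict_space1[OF borel_measurable_indicator]) auto
  qed
  also have "\<dots> \<le> ennreal W"
  proof (rule SUP_least)
    fix n
    let ?N = "lebesgue_on (?I n)"
    have "AE s in ?N. 0 \<le> f s"
      by (rule AE_lebesgue_on_subset[OF nonneg]) auto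
    then have "(\<integral>\<^sup>+ s. ennreal (f s) \<partial>?N) = ennreal (LINT s|?N. f s)"
      by (intro nn_integral_eq_integral int) simp_all
    moreover have "(\<integral>\<^sup>+ s. ennreal (f s) * indicator (?I n) s \<partial>?M) = (\<integral>\<^sup>+ s. ennreal (f s) \<partial>?N)"
      by (simp add: nn_integral_restrict_space)
        (auto intro!: nn_integral_cong simp: indicator_def)
    ultimately show "(\<integral>\<^sup>+ s. ennreal (f s) * indicator (?I n) s \<partial>?M) \<le> ennreal W"
      using le[of "real (Suc n)"] by (simp add: ennreal_leI)
  qed
  finally show ?thesis .
qed

lemma nn_integral_exp_half_line:
  assumes "\<theta> > 0" "C \<ge> 0"
  shows "(\<integral>\<^sup>+ t. ennreal (C * exp (- \<theta> * t)) \<partial>lebesgue_on {0..}) = ennreal (C / \<theta>)"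
proof -
  have "(\<integral>\<^sup>+ t. ennreal (C * exp (- \<theta> * t)) \<partial>lebesgue_on {0..})
      = (\<integral>\<^sup>+ t. ennreal (C * exp (- \<theta> * t)) * indicator {0..} t \<partial>lborel)"
    by (simp add: nn_integral_restrict_space nn_integral_completion)
  also have "\<dots> = ennreal (0 - - (C / \<theta>) * exp (- \<theta> * 0))"
  proof (rule nn_integral_FTC_atLeast)
    show "(\<lambda>t. C * exp (- \<theta> * t)) \<in> borel_measurable borel" by measurable
    show "((\<lambda>t. - (C / \<theta>) * exp (- \<theta> * t)) has_real_derivative C * exp (- \<theta> * t)) (at t)" for t
      using assms by (auto intro!: derivative_eq_intros)
    show "((\<lambda>t. - (C / \<theta>) * exp (- \<theta> * t)) \<longlongrightarrow> 0) at_top"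
      using assms(1) by real_asymp
  qed (use assms in auto)
  finally show ?thesis by simp
qed

text \<open>Scaling by \<open>k\<close> reduces the claim to the tangent at 1 of u^a / a with a = 1
  - \<sigma>. For a > 0 this is Young's inequality; for a < 0 it follows from ln u \<le> u - 1 and
  exp(z) \<ge> 1 + z, the order being reversed on division by a.\<close>

lemma powr_tangent:
  fixes \<sigma> c k :: real
  assumes "c > 0" "k > 0" "\<sigma> > 0" "\<sigma> \<noteq> 1"
  shows "c powr (1 - \<sigma>) / (1 - \<sigma>) \<le> k powr (1 - \<sigma>) / (1 - \<sigma>) + k powr (- \<sigma>) * (c - k)"
proof -
  define a where "a = 1 - \<sigma>"
  define u where "u = c / k"
  have u: "u > 0" using assms by (simp add: u_def)
  have a: "a \<noteq> 0" "a < 1" using assms by (auto simp: a_def)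
  have key: "u powr a / a \<le> 1 / a + (u - 1)"
  proof (cases "a > 0")
    case True
    have "u powr a * 1 powr (1 - a) \<le> a * u + (1 - a) * 1"
      using True a u by (intro Youngs_inequality_0) auto
    then show ?thesis using True by (simp add: field_simps)
  next
    case False
    then have "a < 0" using a by simp
    have "1 + a * (u - 1) \<le> 1 + a * ln u"
      using ln_le_minus_one[OF u] \<open>a < 0\<close> by (simp add: mult_left_mono_neg)
    also have "\<dots> \<le> exp (a * ln u)" by (rule exp_ge_add_one_self)
    also have "\<dots> = u powr a" using u by (simp add: powr_def)
    finally show ?thesis using \<open>a < 0\<close> by (simp add: field_simps)
  qed
  have "c powr a / a = k powr a * (u powr a / a)"
    using assms by (simp add: u_def powr_divide)
  also have "\<dots> \<le> k powr a * (1 / a + (u - 1))"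
    by (intro mult_left_mono key) simp
  also have "\<dots> = k powr a / a + k powr a / k * (c - k)"
    using assms by (simp add: u_def field_simps)
  also have "k powr a / k = k powr (- \<sigma>)"
    using assms by (simp add: a_def powr_diff powr_minus field_simps)
  finally show ?thesis by (simp add: a_def)
qed

lemma ereal_integral_nonneg:
  assumes "AE t in M. f t = ereal (g t)" "AE t in M. g t \<ge> 0"
  shows "ereal_integral M f = enn2ereal (\<integral>\<^sup>+ t. ennreal (g t) \<partial>M)"
proof -
  have "(\<integral>\<^sup>+ t. e2ennreal (f t) \<partial>M) = (\<integral>\<^sup>+ t. ennreal (g t) \<partial>M)"
    using assms(1) by (intro nn_integral_cong_AE) (auto elim!: eventually_mono simp: e2ennreal_ereal)
  moreover have "AE t in M. e2ennreal (- f t) = 0"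
    using assms by eventually_elim (simp add: ennreal_neg)
  then have "(\<integral>\<^sup>+ t. e2ennreal (- f t) \<partial>M) = (\<integral>\<^sup>+ t. 0 \<partial>M)"
    by (rule nn_integral_cong_AE)
  ultimately show ?thesis by (simp add: ereal_integral_def zero_ennreal.rep_eq)
qed

lemma ereal_integral_nonpos:
  assumes "AE t in M. f t \<le> 0"
  shows "ereal_integral M f = - enn2ereal (\<integral>\<^sup>+ t. e2ennreal (- f t) \<partial>M)"
proof -
  have "AE t in M. e2ennreal (f t) = 0"
    using assms by eventually_elim (simp add: e2ennreal_neg)
  then have "(\<integral>\<^sup>+ t. e2ennreal (f t) \<partial>M) = (\<integral>\<^sup>+ t. 0 \<partial>M)"
    by (rule nn_integral_cong_AE)
  then show ?thesis by (simp add: ereal_integral_def zero_ennreal.rep_eq)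
qed

text \<open>An integrated form of P \<le> Q + b - a. It is written with sums because the values are
  extended nonnegative reals and \<open>Q\<close> may be infinite; finiteness of the integral of
  \<open>a\<close> permits the cancellation.\<close>

lemma nn_integral_le_cancel:
  assumes [measurable]: "P \<in> borel_measurable M" "Q \<in> borel_measurable M" "a \<in> borel_measurable M" "b \<in> borel_measurable M"
    and le: "AE t in M. P t + a t \<le> Q t + b t"
    and ab: "(\<integral>\<^sup>+ t. b t \<partial>M) \<le> (\<integral>\<^sup>+ t. a t \<partial>M)" and fin: "(\<integral>\<^sup>+ t. a t \<partial>M) < \<infinity>"
  shows "(\<integral>\<^sup>+ t. P t \<partial>M) \<le> (\<integral>\<^sup>+ t. Q t \<partial>M)"
proof -
  have "(\<integral>\<^sup>+ t. P t \<partial>M) + (\<integral>\<^sup>+ t. a t \<partial>M) \<le> (\<integral>\<^sup>+ t. Q t \<partial>M) + (\<integral>\<^sup>+ t. b t \<partial>M)"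
    using nn_integral_mono_AE[OF le] by (simp add: nn_integral_add)
  also have "\<dots> \<le> (\<integral>\<^sup>+ t. Q t \<partial>M) + (\<integral>\<^sup>+ t. a t \<partial>M)"
    using ab by (rule add_left_mono)
  finally show ?thesis
    using fin by (auto simp: add.commute[of _ "\<integral>\<^sup>+ t. a t \<partial>M"] ennreal_add_left_cancel_le)
qed

text \<open>At c = 0 the left side is 0, while the tangent takes the value k^(1 - \<sigma>) (1 / (1
  - \<sigma>) - 1), which is nonnegative for 0 < \<sigma> < 1.\<close>

lemma powr_tangent_nonneg:
  fixes \<sigma> c k :: real
  assumes "c \<ge> 0" "k > 0" "\<sigma> > 0" "\<sigma> < 1"
  shows "c powr (1 - \<sigma>) / (1 - \<sigma>) \<le> k powr (1 - \<sigma>) / (1 - \<sigma>) + k powr (- \<sigma>) * (c - k)"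
proof (cases "c = 0")
  case True
  have "k powr (- \<sigma>) * k = k powr (1 - \<sigma>)"
    using assms powr_add[of k "- \<sigma>" 1] by simp
  moreover have "k powr (1 - \<sigma>) \<le> k powr (1 - \<sigma>) / (1 - \<sigma>)"
    using assms by (simp add: field_simps)
  ultimately show ?thesis using True by simp
next
  case False
  then show ?thesis using assms by (intro powr_tangent) auto
qed

section \<open>Measurability and sign of the utility, and the comparison with exponential
  consumption\<close>

lemma utility_measurable:
  assumes "c \<in> borel_measurable M"
  shows "(\<lambda>t. utility \<sigma> (c t)) \<in> borel_measurable M"
  using assms unfolding utility_def by measurable

lemma utility_nonneg: "\<lbrakk>\<sigma> < 1; c \<ge> 0\<rbrakk> \<Longrightarrow> utility \<sigma> c = ereal (c powr (1 - \<sigma>) / (1 - \<sigma>))"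
  by (auto simp: utility_def)

lemma utility_pos: "c > 0 \<Longrightarrow> utility \<sigma> c = ereal (c powr (1 - \<sigma>) / (1 - \<sigma>))"
  by (simp add: utility_def)

lemma utility_nonpos: "\<sigma> > 1 \<Longrightarrow> utility \<sigma> c \<le> 0"
  by (auto simp: utility_def divide_nonneg_neg)

text \<open>A consumption problem with interest rate \<open>r\<close> and wealth C / \<theta>, of
  which the candidate consumes the fraction \<theta> per unit of time. The relation for \<rho> is
  the Euler equation \<sigma> (r - \<theta>) = r - \<rho>, with r - \<theta> the growth rate of
  consumption.\<close>

locale exponential_consumption =
  fixes r \<rho> \<sigma> \<theta> C :: real
  assumes \<sigma>: "\<sigma> > 0" "\<sigma> \<noteq> 1" and \<theta>: "\<theta> > 0" and C: "C > 0"
    and \<rho>: "\<rho> = \<sigma> * \<theta> + r * (1 - \<sigma>)"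
begin

definition k :: "real \<Rightarrow> real" where
  "k t = C * exp ((r - \<theta>) * t)"

definition discounted_utility :: "(real \<Rightarrow> real) \<Rightarrow> ereal" where
  "discounted_utility c = ereal_integral (lebesgue_on {0..}) (\<lambda>t. ereal (exp (- \<rho> * t)) * utility \<sigma> (c t))"

lemma k_pos: "k t > 0"
  using C by (simp add: k_def)

lemma k_powr: "k t powr p = C powr p * exp ((r - \<theta>) * t * p)"
  using C by (simp add: k_def powr_mult exp_powr_real)

lemma discounted_k_powr_utility: "exp (- \<rho> * t) * k t powr (1 - \<sigma>) = C powr (1 - \<sigma>) * exp (- \<theta> * t)"
  unfolding k_powr \<rho> by (simp add: algebra_simps flip: exp_add)

text \<open>The Euler equation makes discounted marginal utility along \<open>k\<close> proportional
  to the price exp(- r t), so the linear term of the tangent inequality is controlled by the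
  budget.\<close>

lemma discounted_k_powr_marginal: "exp (- \<rho> * t) * k t powr (- \<sigma>) = C powr (- \<sigma>) * exp (- r * t)"
  unfolding k_powr \<rho> by (simp add: algebra_simps flip: exp_add)

lemma discounted_k: "exp (- r * t) * k t = C * exp (- \<theta> * t)"
  unfolding k_def by (simp add: algebra_simps flip: exp_add)

lemma discounted_utility_k:
  assumes "\<And>t. t \<ge> 0 \<Longrightarrow> c t = k t"
  shows "discounted_utility c = ereal (C powr (1 - \<sigma>) / ((1 - \<sigma>) * \<theta>))"
proof -
  let ?M = "lebesgue_on {0::real..}"
  have val: "ereal (exp (- \<rho> * t)) * utility \<sigma> (c t) = ereal (C powr (1 - \<sigma>) / (1 - \<sigma>) * exp (- \<theta> * t))"
    if "t \<ge> 0" for t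
    using that assms discounted_k_powr_utility[of t] by (simp add: utility_pos k_pos)
  show ?thesis
  proof (cases "\<sigma> < 1")
    case True
    have "discounted_utility c = enn2ereal (\<integral>\<^sup>+ t. ennreal (C powr (1 - \<sigma>) / (1 - \<sigma>) * exp (- \<theta> * t)) \<partial>?M)"
      unfolding discounted_utility_def
      using val True by (intro ereal_integral_nonneg AE_I2) auto
    also have "(\<integral>\<^sup>+ t. ennreal (C powr (1 - \<sigma>) / (1 - \<sigma>) * exp (- \<theta> * t)) \<partial>?M)
        = ennreal (C powr (1 - \<sigma>) / (1 - \<sigma>) / \<theta>)"
      using True \<theta> by (intro nn_integral_exp_half_line) auto
    finally show ?thesis
      using True \<theta> by (simp add: enn2ereal_ennreal)
  next
    case False
    then have "\<sigma> > 1" using \<sigma> by simp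
    have "discounted_utility c
        = - enn2ereal (\<integral>\<^sup>+ t. e2ennreal (- (ereal (exp (- \<rho> * t)) * utility \<sigma> (c t))) \<partial>?M)"
      unfolding discounted_utility_def
      using \<open>\<sigma> > 1\<close> by (intro ereal_integral_nonpos AE_I2) (simp add: utility_nonpos mult_nonneg_nonpos ereal_mult_le_0_iff)
    also have "(\<integral>\<^sup>+ t. e2ennreal (- (ereal (exp (- \<rho> * t)) * utility \<sigma> (c t))) \<partial>?M)
        = (\<integral>\<^sup>+ t. ennreal (C powr (1 - \<sigma>) / (\<sigma> - 1) * exp (- \<theta> * t)) \<partial>?M)"
    proof (rule nn_integral_cong)
      fix t assume "t \<in> space ?M"
      then have t: "t \<ge> 0" by simp
      have "- (ereal (exp (- \<rho> * t)) * utility \<sigma> (c t)) = ereal (C powr (1 - \<sigma>) / (\<sigma> - 1) * exp (- \<theta> * t))"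
        unfolding val[OF t] using \<open>\<sigma> > 1\<close> by (simp add: field_simps)
      then show "e2ennreal (- (ereal (exp (- \<rho> * t)) * utility \<sigma> (c t)))
          = ennreal (C powr (1 - \<sigma>) / (\<sigma> - 1) * exp (- \<theta> * t))"
        by (simp add: e2ennreal_ereal)
    qed
    also have "\<dots> = ennreal (C powr (1 - \<sigma>) / (\<sigma> - 1) / \<theta>)"
      using \<open>\<sigma> > 1\<close> \<theta> by (intro nn_integral_exp_half_line) auto
    finally show ?thesis
      using \<open>\<sigma> > 1\<close> \<theta> by (simp add: enn2ereal_ennreal field_simps)
  qed
qed

lemma discounted_utility_le:
  assumes c[measurable]: "c \<in> borel_measurable (lebesgue_on {0..})"
    and nonneg: "AE t in lebesgue_on {0..}. 0 \<le> c t"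
    and budget: "(\<integral>\<^sup>+ t. ennreal (exp (- r * t) * c t) \<partial>lebesgue_on {0..}) \<le> ennreal (C / \<theta>)"
  shows "discounted_utility c \<le> ereal (C powr (1 - \<sigma>) / ((1 - \<sigma>) * \<theta>))"
proof -
  let ?M = "lebesgue_on {0::real..}"
  \<comment> \<open>The Lagrange multiplier of the budget constraint.\<close>
  define D where "D = C powr (- \<sigma>)"
  have D: "D > 0" using C by (simp add: D_def)
  have mexp[measurable]: "(\<lambda>t. exp (q * t)) \<in> borel_measurable ?M" for q :: real
    by (intro continuous_imp_measurable_on_sets_lebesgue continuous_intros) auto
  \<comment> \<open>The price-weighted consumption of the candidate \<open>k\<close> and of the
    competitor \<open>c\<close>, both times the multiplier. The candidate spends exactly C /
    \<theta>.\<close>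
  let ?a = "\<lambda>t. ennreal (D * C * exp (- \<theta> * t))" and ?b = "\<lambda>t. ennreal (D * (exp (- r * t) * c t))"
  have ma: "?a \<in> borel_measurable ?M" and mb: "?b \<in> borel_measurable ?M" by measurable
  have ia: "(\<integral>\<^sup>+ t. ?a t \<partial>?M) = ennreal (D * C / \<theta>)"
    using \<theta> C D by (intro nn_integral_exp_half_line) auto
  have "(\<integral>\<^sup>+ t. ?b t \<partial>?M) = ennreal D * (\<integral>\<^sup>+ t. ennreal (exp (- r * t) * c t) \<partial>?M)"
  proof -
    have "(\<lambda>t. ennreal (exp (- r * t) * c t)) \<in> borel_measurable ?M" by measurable
    from nn_integral_cmult[OF this, of "ennreal D"] show ?thesis
      using D by (simp add: ennreal_mult')
  qed
  also have "\<dots> \<le> ennreal D * ennreal (C / \<theta>)" by (intro mult_left_mono budget) simp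
  also have "\<dots> = ennreal (D * C / \<theta>)" using D C \<theta> by (simp add: ennreal_mult[symmetric])
  finally have ab: "(\<integral>\<^sup>+ t. ?b t \<partial>?M) \<le> (\<integral>\<^sup>+ t. ?a t \<partial>?M)" unfolding ia .
  have fin: "(\<integral>\<^sup>+ t. ?a t \<partial>?M) < \<infinity>" unfolding ia by simp
  \<comment> \<open>Here \<open>z\<close> stands for consumption and \<open>u\<close> for its power
    with exponent 1 - \<sigma>. They are kept separate because the two ranges of \<sigma> use
    different tangent inequalities.\<close>
  have tangent: "exp (- \<rho> * t) * (u / (1 - \<sigma>)) + D * C * exp (- \<theta> * t)
      \<le> C powr (1 - \<sigma>) / (1 - \<sigma>) * exp (- \<theta> * t) + D * (exp (- r * t) * z)"
    if "u / (1 - \<sigma>) \<le> k t powr (1 - \<sigma>) / (1 - \<sigma>) + k t powr (- \<sigma>) * (z - k t)" for t u z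
  proof -
    have "exp (- \<rho> * t) * (u / (1 - \<sigma>))
        \<le> exp (- \<rho> * t) * (k t powr (1 - \<sigma>) / (1 - \<sigma>) + k t powr (- \<sigma>) * (z - k t))"
      using that by (intro mult_left_mono) auto
    also have "\<dots> = (exp (- \<rho> * t) * k t powr (1 - \<sigma>)) / (1 - \<sigma>)
        + (exp (- \<rho> * t) * k t powr (- \<sigma>)) * z - (exp (- \<rho> * t) * k t powr (- \<sigma>)) * k t"
      by (simp add: algebra_simps)
    also have "\<dots> = C powr (1 - \<sigma>) * exp (- \<theta> * t) / (1 - \<sigma>) + D * exp (- r * t) * z - D * (exp (- r * t) * k t)"
      unfolding discounted_k_powr_utility discounted_k_powr_marginal D_def by simp
    finally show ?thesis unfolding discounted_k by (simp add: algebra_simps)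
  qed
  show ?thesis
  proof (cases "\<sigma> < 1")
    case True
    let ?P = "\<lambda>t. ennreal (exp (- \<rho> * t) * (c t powr (1 - \<sigma>) / (1 - \<sigma>)))"
    let ?Q = "\<lambda>t. ennreal (C powr (1 - \<sigma>) / (1 - \<sigma>) * exp (- \<theta> * t))"
    have "discounted_utility c = enn2ereal (\<integral>\<^sup>+ t. ?P t \<partial>?M)"
      unfolding discounted_utility_def
    proof (rule ereal_integral_nonneg)
      show "AE t in ?M. ereal (exp (- \<rho> * t)) * utility \<sigma> (c t)
          = ereal (exp (- \<rho> * t) * (c t powr (1 - \<sigma>) / (1 - \<sigma>)))"
        using nonneg by eventually_elim (simp add: utility_nonneg True)
      show "AE t in ?M. 0 \<le> exp (- \<rho> * t) * (c t powr (1 - \<sigma>) / (1 - \<sigma>))"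
        using True by simp
    qed
    also have "(\<integral>\<^sup>+ t. ?P t \<partial>?M) \<le> (\<integral>\<^sup>+ t. ?Q t \<partial>?M)"
    proof (rule nn_integral_le_cancel[OF _ _ ma mb _ ab fin])
      show "?P \<in> borel_measurable ?M" "?Q \<in> borel_measurable ?M" by measurable
      show "AE t in ?M. ?P t + ?a t \<le> ?Q t + ?b t"
        using nonneg
      proof eventually_elim
        case (elim t)
        have "exp (- \<rho> * t) * (c t powr (1 - \<sigma>) / (1 - \<sigma>)) + D * C * exp (- \<theta> * t)
            \<le> C powr (1 - \<sigma>) / (1 - \<sigma>) * exp (- \<theta> * t) + D * (exp (- r * t) * c t)"
          using elim True \<sigma> k_pos by (intro tangent powr_tangent_nonneg) auto
        then show ?case
          using elim True D C by (simp add: ennreal_leI flip: ennreal_plus)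
      qed
    qed
    also have "(\<integral>\<^sup>+ t. ?Q t \<partial>?M) = ennreal (C powr (1 - \<sigma>) / (1 - \<sigma>) / \<theta>)"
      using True \<theta> by (intro nn_integral_exp_half_line) auto
    finally show ?thesis
      using True \<theta> by (simp add: enn2ereal_ennreal less_eq_ennreal.rep_eq)
  next
    case False
    then have \<sigma>1: "\<sigma> > 1" using \<sigma> by simp
    \<comment> \<open>For \<sigma> > 1 utility is nonpositive, so disutilities are integrated:
      \<open>?P\<close> belongs to the candidate and \<open>?Q\<close> to the competitor.\<close>
    let ?P = "\<lambda>t. ennreal (C powr (1 - \<sigma>) / (\<sigma> - 1) * exp (- \<theta> * t))"
    let ?Q = "\<lambda>t. e2ennreal (- (ereal (exp (- \<rho> * t)) * utility \<sigma> (c t)))"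
    have "discounted_utility c = - enn2ereal (\<integral>\<^sup>+ t. ?Q t \<partial>?M)"
      unfolding discounted_utility_def
      using \<sigma>1 by (intro ereal_integral_nonpos AE_I2) (simp add: utility_nonpos ereal_mult_le_0_iff)
    moreover have "(\<integral>\<^sup>+ t. ?P t \<partial>?M) \<le> (\<integral>\<^sup>+ t. ?Q t \<partial>?M)"
    proof (rule nn_integral_le_cancel[OF _ _ ma mb _ ab fin])
      have [measurable]: "(\<lambda>t. utility \<sigma> (c t)) \<in> borel_measurable ?M" by (rule utility_measurable[OF c])
      show "?P \<in> borel_measurable ?M" "?Q \<in> borel_measurable ?M" by measurable
      show "AE t in ?M. ?P t + ?a t \<le> ?Q t + ?b t"
        using nonneg
      proof eventually_elim
        case (elim t)
        show ?case
        \<comment> \<open>Zero consumption has utility minus infinity, so \<open>?Q\<close> is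
          infinite there and the inequality is trivial; the tangent inequality covers positive
          consumption.\<close>
        proof (cases "c t = 0")
          case True
          then have "?Q t = top" using \<sigma>1 by (simp add: utility_def)
          then show ?thesis by simp
        next
          case False
          then have pos: "c t > 0" using elim by simp
          have "exp (- \<rho> * t) * (c t powr (1 - \<sigma>) / (1 - \<sigma>)) + D * C * exp (- \<theta> * t)
              \<le> C powr (1 - \<sigma>) / (1 - \<sigma>) * exp (- \<theta> * t) + D * (exp (- r * t) * c t)"
            using pos \<sigma> k_pos by (intro tangent powr_tangent) auto
          moreover have "u / (1 - \<sigma>) = - (u / (\<sigma> - 1))" for u :: real
            using minus_divide_right[of u "\<sigma> - 1"] by simp
          ultimately have "C powr (1 - \<sigma>) / (\<sigma> - 1) * exp (- \<theta> * t) + D * C * exp (- \<theta> * t)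
              \<le> exp (- \<rho> * t) * (c t powr (1 - \<sigma>) / (\<sigma> - 1)) + D * (exp (- r * t) * c t)"
            by simp
          moreover have "?Q t = ennreal (exp (- \<rho> * t) * (c t powr (1 - \<sigma>) / (\<sigma> - 1)))"
            using \<open>\<And>u. u / (1 - \<sigma>) = - (u / (\<sigma> - 1))\<close> by (simp add: utility_pos[OF pos] e2ennreal_ereal)
          ultimately show ?thesis
            using pos \<sigma>1 D C by (simp add: ennreal_leI flip: ennreal_plus)
        qed
      qed
    qed
    moreover have "(\<integral>\<^sup>+ t. ?P t \<partial>?M) = ennreal (C powr (1 - \<sigma>) / (\<sigma> - 1) / \<theta>)"
      using \<sigma>1 \<theta> by (intro nn_integral_exp_half_line) auto
    ultimately have "discounted_utility c \<le> - enn2ereal (ennreal (C powr (1 - \<sigma>) / (\<sigma> - 1) / \<theta>))"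
      by (simp add: less_eq_ennreal.rep_eq)
    also have "\<dots> = ereal (- (C powr (1 - \<sigma>) / (\<sigma> - 1) / \<theta>))"
      using \<sigma>1 \<theta> by (simp add: enn2ereal_ennreal)
    also have "- (C powr (1 - \<sigma>) / (\<sigma> - 1) / \<theta>) = C powr (1 - \<sigma>) / ((1 - \<sigma>) * \<theta>)"
      using \<sigma>1 \<theta> by (simp add: field_simps)
    finally show ?thesis .
  qed
qed

end

section \<open>Optimality of the feedback\<close>

text \<open>The function \<open>f\<close> vanishes at 0 with slope A T - 1 > 0 and is negative at A,
  which gives a positive root. Two positive roots would produce two critical points by the mean
  value theorem, although the derivative is strictly decreasing.\<close>

lemma xi_root:
  assumes A: "A > 0" and T: "T > 0" and AT: "A * T > 1"
  shows "xi A T > 0 \<and> xi A T = A * (1 - exp (- xi A T * T))"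
proof -
  define f where "f z = A * (1 - exp (- z * T)) - z" for z :: real
  have D: "(f has_real_derivative A * T * exp (- z * T) - 1) (at z)" for z
    unfolding f_def by (auto intro!: derivative_eq_intros)
  have cf: "continuous_on S f" for S
    using D DERIV_isCont continuous_at_imp_continuous_on by blast
  have "\<exists>z>0. f z = 0"
  proof -
    have "A * T * exp (- 0 * T) - 1 > 0" using AT by simp
    from DERIV_pos_inc_right[OF D this] obtain d where d: "d > 0" "\<And>h. h > 0 \<Longrightarrow> h < d \<Longrightarrow> f 0 < f (0 + h)"
      by blast
    define w where "w = min (d / 2) (A / 2)"
    have w: "w > 0" "w < d" "w \<le> A" using d A by (auto simp: w_def)
    have "f w > 0" using d(2)[OF w(1,2)] by (simp add: f_def)
    moreover have "f A < 0" using A by (simp add: f_def algebra_simps)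
    ultimately obtain z where "w \<le> z" "f z = 0"
      using IVT2'[of f A 0 w] w(3) cf by (meson less_imp_le)
    then show ?thesis using w(1) by (intro exI[of _ z]) auto
  qed
  moreover have False if z: "0 < z1" "z1 < z2" "f z1 = 0" "f z2 = 0" for z1 z2
  proof -
    from MVT2[OF z(1) D] obtain p where p: "p < z1" "f z1 - f 0 = (z1 - 0) * (A * T * exp (- p * T) - 1)"
      by blast
    from MVT2[OF z(2) D] obtain q where q: "z1 < q" "f z2 - f z1 = (z2 - z1) * (A * T * exp (- q * T) - 1)"
      by blast
    have "A * T * exp (- p * T) = A * T * exp (- q * T)"
      using p q z by (simp add: f_def)
    then show False using p q A T by simp
  qed
  ultimately have "\<exists>!z. z > 0 \<and> f z = 0"
    by (intro ex_ex1I) (blast, meson linorder_cases)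
  moreover have "f z = 0 \<longleftrightarrow> z = A * (1 - exp (- z * T))" for z
    by (auto simp: f_def)
  ultimately have "\<exists>!z. z > 0 \<and> z = A * (1 - exp (- z * T))" by simp
  then show ?thesis unfolding xi_def by (rule theI')
qed

section \<open>The exponential functional under the feedback, and the budget of a general
  control\<close>

lemma Gamma0_eq_X_inner: "Gamma0 A T z = X_inner T z (1, \<lambda>s. exp (xi A T * s))"
  by (simp add: Gamma0_def X_inner_def mult.commute)

text \<open>Consumption proportional to the functional makes the discounted functional
  \<open>H\<close> solve H' = - \<theta> H. The equation is first available in integral form;
  continuity of \<open>H\<close> makes it classical, and then exp(\<theta> t) H(t) is
  constant.\<close>

lemma (in trajectory) closed_loop_functional:
  assumes A: "A > 0" and r: "r > 0" and root: "r = A * (1 - exp (- r * T))"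
    and i: "\<And>t. t \<ge> 0 \<Longrightarrow> A * fst (y t) - i t = \<theta> * (A / r) * X_inner T (y t) (1, \<lambda>s. exp (r * s))"
    and t: "t \<ge> 0"
  shows "X_inner T (y t) (1, \<lambda>s. exp (r * s)) = X_inner T (y 0) (1, \<lambda>s. exp (r * s)) * exp ((r - \<theta>) * t)"
proof -
  define H where "H u = exp (- r * u) * X_inner T (y u) (1, \<lambda>s. exp (r * s))" for u
  let ?\<tau> = "t + 1"
  have cH: "continuous_on {0..?\<tau>} H"
    unfolding H_def by (intro continuous_intros continuous_inner)
  have HI: "((\<lambda>s. - \<theta> * H s) has_integral H u - H 0) {0..u}" if u: "u \<ge> 0" for u
  proof -
    have "((\<lambda>s. exp (- r * s) * (A * fst (y s) - i s)) has_integral A / r * (H 0 - H u)) {0..u}"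
      using discounted_equation[OF A r root order_refl u] by (simp add: H_def)
    then have "((\<lambda>s. A / r * (\<theta> * H s)) has_integral A / r * (H 0 - H u)) {0..u}"
      by (rule has_integral_eq[rotated]) (simp add: i H_def)
    from has_integral_mult_right[OF this, of "- (r / A)"] show ?thesis
      using A r by simp
  qed
  have "((\<lambda>u. exp (\<theta> * u) * H u) has_real_derivative 0) (at u within {0..?\<tau>})"
    if u: "u \<in> {0..?\<tau>}" for u
  proof -
    have "continuous_on {0..?\<tau>} (\<lambda>s. - \<theta> * H s)" by (intro continuous_intros cH)
    from integral_has_vector_derivative[OF this u]
    have I: "((\<lambda>v. integral {0..v} (\<lambda>s. - \<theta> * H s)) has_real_derivative - \<theta> * H u) (at u within {0..?\<tau>})"
      by (simp only: has_real_derivative_iff_has_vector_derivative)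
    have "((\<lambda>v. H 0 + integral {0..v} (\<lambda>s. - \<theta> * H s)) has_real_derivative - \<theta> * H u) (at u within {0..?\<tau>})"
      by (rule DERIV_cong[OF DERIV_add[OF DERIV_const I]]) simp
    then have DH: "(H has_real_derivative - \<theta> * H u) (at u within {0..?\<tau>})"
    proof (rule has_field_derivative_transform_within[OF _ zero_less_one u])
      fix v assume "v \<in> {0..?\<tau>}"
      then have "integral {0..v} (\<lambda>s. - \<theta> * H s) = H v - H 0" by (intro integral_unique HI) simp
      then show "H 0 + integral {0..v} (\<lambda>s. - \<theta> * H s) = H v" by linarith
    qed
    have De: "((\<lambda>u. exp (\<theta> * u)) has_real_derivative \<theta> * exp (\<theta> * u)) (at u within {0..?\<tau>})"
      by (auto intro!: derivative_eq_intros)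
    show ?thesis
      by (rule DERIV_cong[OF DERIV_mult[OF De DH]]) simp
  qed
  then obtain c where c: "\<And>u. u \<in> {0..?\<tau>} \<Longrightarrow> exp (\<theta> * u) * H u = c"
    using has_field_derivative_zero_constant[of "{0..?\<tau>}" "\<lambda>u. exp (\<theta> * u) * H u"] by auto
  have "exp (\<theta> * t) * H t = H 0" using c[of t] c[of 0] t by simp
  then have "H t = H 0 * exp (- \<theta> * t)"
    by (simp add: exp_minus field_simps)
  moreover have "X_inner T (y t) (1, \<lambda>s. exp (r * s)) = exp (r * t) * H t"
    by (simp add: H_def exp_minus)
  moreover have "X_inner T (y 0) (1, \<lambda>s. exp (r * s)) = H 0"
    by (simp add: H_def)
  ultimately show ?thesis
    by (simp add: left_diff_distrib exp_diff exp_minus field_simps)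
qed

text \<open>On a finite horizon discounted spending is initial wealth minus discounted terminal
  wealth, and the latter is nonnegative.\<close>

lemma (in trajectory) discounted_consumption_le:
  assumes A: "A > 0" and r: "r > 0" and root: "r = A * (1 - exp (- r * T))"
    and adm: "AE t in lebesgue_on {0..}. 0 \<le> i t \<and> i t \<le> A * fst (y t)"
    and x_nonpos: "AE s in lebesgue_on {- T..0}. snd x s \<le> 0"
  shows "(\<lambda>t. A * fst (y t) - i t) \<in> borel_measurable (lebesgue_on {0..})"
    and "(\<integral>\<^sup>+ t. ennreal (exp (- r * t) * (A * fst (y t) - i t)) \<partial>lebesgue_on {0..})
      \<le> ennreal (A / r * X_inner T (y 0) (1, \<lambda>s. exp (r * s)))"
proof -
  have L: "L2 0 \<tau> (\<lambda>t. A * fst (y t) - i t)" if \<tau>: "\<tau> > 0" for \<tau>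
  proof -
    \<comment> \<open>Writing the first component as a pairing makes its continuity in time an
      instance of the continuity of pairings.\<close>
    have "X_inner T (y t) (1, \<lambda>_. 0) = fst (y t)" for t by (simp add: X_inner_def)
    then have "L2 0 \<tau> (\<lambda>t. fst (y t))"
      using L2_continuous[OF continuous_inner[of "\<lambda>_. 0" \<tau> 1]] by (simp add: continuous_on_const)
    from L2_linear_combination[OF this control_L2[OF \<tau>], of A "- 1"] show ?thesis by simp
  qed
  show "(\<lambda>t. A * fst (y t) - i t) \<in> borel_measurable (lebesgue_on {0..})"
    using L by (intro borel_measurable_half_line) (simp add: L2_def)
  have int: "integrable (lebesgue_on {0..\<tau>}) (\<lambda>t. exp (- r * t) * (A * fst (y t) - i t))" if "\<tau> > 0" for \<tau>
    by (intro L2_mult_integrable L that L2_continuous continuous_intros)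
  show "(\<integral>\<^sup>+ t. ennreal (exp (- r * t) * (A * fst (y t) - i t)) \<partial>lebesgue_on {0..})
      \<le> ennreal (A / r * X_inner T (y 0) (1, \<lambda>s. exp (r * s)))"
  proof (rule nn_integral_half_line_le[OF int])
    show "AE t in lebesgue_on {0..}. 0 \<le> exp (- r * t) * (A * fst (y t) - i t)"
      using adm by eventually_elim simp
    fix \<tau> :: real assume \<tau>: "\<tau> > 0"
    have "(LINT t|lebesgue_on {0..\<tau>}. exp (- r * t) * (A * fst (y t) - i t))
        = integral {0..\<tau>} (\<lambda>t. exp (- r * t) * (A * fst (y t) - i t))"
      by (rule lebesgue_integral_eq_integral[OF int[OF \<tau>]]) simp
    also have "\<dots> = A / r * (exp (- r * 0) * X_inner T (y 0) (1, \<lambda>s. exp (r * s))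
        - exp (- r * \<tau>) * X_inner T (y \<tau>) (1, \<lambda>s. exp (r * s)))"
      by (rule integral_unique[OF discounted_equation[OF A r root order_refl less_imp_le[OF \<tau>]]])
    also have "\<dots> \<le> A / r * X_inner T (y 0) (1, \<lambda>s. exp (r * s))"
      using exp_functional_nonneg[OF A r root adm x_nonpos, of \<tau>] A r \<tau> by (intro mult_left_mono) auto
    finally show "(LINT t|lebesgue_on {0..\<tau>}. exp (- r * t) * (A * fst (y t) - i t))
        \<le> A / r * X_inner T (y 0) (1, \<lambda>s. exp (r * s))" .
  qed
qed

text \<open>A solution starts at the given state only up to a null set of the history, so the
  functional has to respect this equivalence.\<close>

lemma Gamma0_X_eq:
  assumes "X_eq T z x" "z \<in> X_space T" "x \<in> X_space T"
  shows "Gamma0 A T z = Gamma0 A T x"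
proof -
  have "(LINT s|lebesgue_on {- T..0}. exp (xi A T * s) * snd z s)
      = (LINT s|lebesgue_on {- T..0}. exp (xi A T * s) * snd x s)"
  proof (rule integral_cong_AE)
    have "(\<lambda>s. exp (xi A T * s)) \<in> borel_measurable (lebesgue_on {- T..0})"
      by (intro continuous_imp_measurable_on_sets_lebesgue continuous_intros) auto
    then show "(\<lambda>s. exp (xi A T * s) * snd z s) \<in> borel_measurable (lebesgue_on {- T..0})"
      "(\<lambda>s. exp (xi A T * s) * snd x s) \<in> borel_measurable (lebesgue_on {- T..0})"
      using assms by (auto simp: X_space_def L2_def)
    show "AE s in lebesgue_on {- T..0}. exp (xi A T * s) * snd z s = exp (xi A T * s) * snd x s"
      using assms by (auto simp: X_eq_def elim: eventually_mono)
  qed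
  then show ?thesis using assms by (simp add: Gamma0_def X_eq_def)
qed

text \<open>Taking the power - 1 / \<sigma> of \<open>nu\<close> leaves \<theta> with exponent 1,
  and the exponents of A / \<xi> add up to 1. Thus the feedback consumes the fraction \<theta> of
  the wealth (A / \<xi>) \<open>Gamma0\<close>.\<close>

lemma feedback_coefficient:
  assumes A: "A > 0" and r: "xi A T > 0" and \<sigma>: "\<sigma> > 0" and \<theta>: "\<theta> = (\<rho> - xi A T * (1 - \<sigma>)) / \<sigma>" "\<theta> > 0"
  shows "nu A T \<rho> \<sigma> powr (- 1 / \<sigma>) * (A / xi A T) powr (1 / \<sigma>) = \<theta> * (A / xi A T)"
proof -
  define q where "q = A / xi A T"
  have q: "q > 0" using A r by (simp add: q_def)
  have "nu A T \<rho> \<sigma> powr (- 1 / \<sigma>) * q powr (1 / \<sigma>)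
      = \<theta> powr (- \<sigma> * (- 1 / \<sigma>)) * q powr ((1 - \<sigma>) * (- 1 / \<sigma>)) * q powr (1 / \<sigma>)"
    using q \<theta> by (simp add: nu_def q_def[symmetric] powr_mult powr_powr)
  also have "\<dots> = \<theta> powr (- \<sigma> * (- 1 / \<sigma>)) * q powr ((1 - \<sigma>) * (- 1 / \<sigma>) + 1 / \<sigma>)"
    by (simp only: powr_add mult.assoc)
  also have "- \<sigma> * (- 1 / \<sigma>) = 1" using \<sigma> by simp
  also have "(1 - \<sigma>) * (- 1 / \<sigma>) + 1 / \<sigma> = 1" using \<sigma> by (simp add: field_simps)
  finally have "nu A T \<rho> \<sigma> powr (- 1 / \<sigma>) * q powr (1 / \<sigma>) = \<theta> * q" using q \<theta>(2) by simp
  then show ?thesis by (simp only: q_def)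
qed

text \<open>This puts the explicit value in the form of the discounted utility of an exponential
  path whose initial consumption is \<theta> (A / \<xi>) \<open>Gamma0\<close>.\<close>

lemma v_explicit_eq:
  assumes A: "A > 0" and r: "xi A T > 0" and \<theta>: "\<theta> = (\<rho> - xi A T * (1 - \<sigma>)) / \<sigma>" "\<theta> > 0"
    and g: "Gamma0 A T x > 0"
  shows "v_explicit A T \<rho> \<sigma> x = (\<theta> * (A / xi A T) * Gamma0 A T x) powr (1 - \<sigma>) / ((1 - \<sigma>) * \<theta>)"
proof -
  have "\<theta> powr (1 - \<sigma>) = \<theta> powr (- \<sigma>) * \<theta>"
    using \<theta>(2) powr_add[of \<theta> "- \<sigma>" 1] by simp
  then have "(\<theta> * q * Gamma0 A T x) powr (1 - \<sigma>)
      = \<theta> powr (- \<sigma>) * q powr (1 - \<sigma>) * Gamma0 A T x powr (1 - \<sigma>) * \<theta>" if "q > 0" for q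
    using that \<theta>(2) g by (simp add: powr_mult)
  from this[of "A / xi A T"] have "(\<theta> * (A / xi A T) * Gamma0 A T x) powr (1 - \<sigma>)
      = \<theta> powr (- \<sigma>) * (A / xi A T) powr (1 - \<sigma>) * Gamma0 A T x powr (1 - \<sigma>) * \<theta>"
    using A r by simp
  then show ?thesis
    using \<theta>(2) by (simp add: v_explicit_def nu_def flip: \<theta>(1))
qed

theorem theorem5p11:
  fixes A T \<rho> \<sigma> :: real and x :: state and y :: "real \<Rightarrow> state"
  assumes "A > 0" and "T > 0" and "\<rho> > 0" and "\<sigma> > 0" and "\<sigma> \<noteq> 1"
    and "A * T > 1"
    and "\<rho> > xi A T * (1 - \<sigma>)"
    and "x \<in> O_region A T \<rho> \<sigma>"
    and "fst x > 0"
    and "AE s in lebesgue_on {- T..0}. snd x s \<le> 0"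
    and "state_solution T x (\<lambda>t. feedback A T \<rho> \<sigma> (y t)) y"
    and "\<forall>t\<ge>0. y t \<in> O_region A T \<rho> \<sigma>"
  shows "optimal_control A T \<rho> \<sigma> x (\<lambda>t. feedback A T \<rho> \<sigma> (y t)) \<and>
         value_function A T \<rho> \<sigma> x = ereal (v_explicit A T \<rho> \<sigma> x)"
proof -
  define r where "r = xi A T"
  define \<theta> where "\<theta> = (\<rho> - r * (1 - \<sigma>)) / \<sigma>"
  define g where "g = Gamma0 A T x"
  define C where "C = \<theta> * (A / r) * g"
  have r: "r > 0" and root: "r = A * (1 - exp (- r * T))"
    using xi_root[OF assms(1,2,6)] by (simp_all add: r_def)
  have \<theta>: "\<theta> > 0" using assms(4,7) by (simp add: \<theta>_def r_def)
  have x: "x \<in> X_space T" and g: "g > 0" using assms(8) by (auto simp: O_region_def g_def)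
  have C: "C > 0" using \<theta> r g assms(1) by (simp add: C_def)
  interpret exponential_consumption r \<rho> \<sigma> \<theta> C
    using assms(4,5) \<theta> C by unfold_locales (auto simp: \<theta>_def)
  have coeff: "nu A T \<rho> \<sigma> powr (- 1 / \<sigma>) * (A / xi A T) powr (1 / \<sigma>) = \<theta> * (A / r)"
    using feedback_coefficient[OF assms(1), of T \<sigma> \<theta> \<rho>] r \<theta> assms(4) by (simp add: r_def \<theta>_def)
  have v: "v_explicit A T \<rho> \<sigma> x = C powr (1 - \<sigma>) / ((1 - \<sigma>) * \<theta>)"
    using v_explicit_eq[OF assms(1), of T \<theta> \<rho> \<sigma> x] r \<theta> g by (simp add: r_def \<theta>_def g_def C_def)
  have initial: "X_inner T (z 0) (1, \<lambda>s. exp (r * s)) = g" if "state_solution T x i z" for i z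
  proof -
    have "X_continuous_on T {0..1} z" "X_eq T (z 0) x"
      using that by (simp_all add: state_solution_def)
    then have "z 0 \<in> X_space T" by (simp add: X_continuous_on_def)
    with \<open>X_eq T (z 0) x\<close> x Gamma0_X_eq[of T "z 0" x A] show ?thesis
      by (simp add: g_def r_def Gamma0_eq_X_inner)
  qed
  \<comment> \<open>Every admissible control starts from the same value \<open>g\<close> of the
    functional, hence has the same budget C / \<theta>.\<close>
  have upper: "objective A \<rho> \<sigma> i z \<le> ereal (v_explicit A T \<rho> \<sigma> x)" if adm: "admissible_pair A T x i z" for i z
  proof -
    interpret z: trajectory T x i z
      using adm assms(2) by unfold_locales (auto simp: admissible_pair_def)
    have adm': "AE t in lebesgue_on {0..}. 0 \<le> i t \<and> i t \<le> A * fst (z t)"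
      using adm by (simp add: admissible_pair_def)
    note bound = z.discounted_consumption_le[OF assms(1) r root adm' assms(10)]
    have "(\<integral>\<^sup>+ t. ennreal (exp (- r * t) * (A * fst (z t) - i t)) \<partial>lebesgue_on {0..}) \<le> ennreal (C / \<theta>)"
      using bound(2) \<theta> by (simp add: initial[OF z.sol] C_def)
    moreover have "AE t in lebesgue_on {0..}. 0 \<le> A * fst (z t) - i t"
      using adm' by eventually_elim simp
    ultimately show ?thesis
      using discounted_utility_le[OF bound(1)] by (simp add: v objective_def discounted_utility_def)
  qed
  let ?u = "\<lambda>t. feedback A T \<rho> \<sigma> (y t)"
  have fb: "?u t = A * fst (y t) - \<theta> * (A / r) * X_inner T (y t) (1, \<lambda>s. exp (r * s))" for t
    unfolding feedback_def coeff by (simp add: Gamma0_eq_X_inner r_def)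
  \<comment> \<open>The feedback is a combination of pairings with the state, so it is continuous in
    time; this supplies the square integrability required of a control.\<close>
  have u_L2: "L2 0 \<tau> ?u" if "\<tau> > 0" for \<tau>
  proof (rule L2_continuous)
    have "X_continuous_on T {0..\<tau>} y" using assms(11) that by (simp add: state_solution_def)
    from continuous_on_X_inner[OF this assms(2)]
    have c: "continuous_on {- T..0} \<phi> \<Longrightarrow> continuous_on {0..\<tau>} (\<lambda>t. X_inner T (y t) (1, \<phi>))" for \<phi>
      by blast
    have "X_inner T (y t) (1, \<lambda>_. 0) = fst (y t)" for t by (simp add: X_inner_def)
    with c[of "\<lambda>_. 0"] have cf: "continuous_on {0..\<tau>} (\<lambda>t. fst (y t))" by (simp add: continuous_on_const)
    have ce: "continuous_on {- T..0} (\<lambda>s. exp (r * s))" by (intro continuous_intros)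
    show "continuous_on {0..\<tau>} ?u"
      unfolding fb by (intro continuous_on_diff continuous_on_mult continuous_on_const cf c ce)
  qed
  interpret y: trajectory T x ?u y
    using assms(2,11) u_L2 by unfold_locales auto
  have "0 \<le> ?u t \<and> ?u t \<le> A * fst (y t)" if "t \<ge> 0" for t
  proof -
    have "y t \<in> O_region A T \<rho> \<sigma>" using assms(12) that by blast
    then have "Gamma0 A T (y t) > 0" "A * fst (y t) > \<theta> * (A / r) * Gamma0 A T (y t)"
      unfolding O_region_def coeff by auto
    then show ?thesis using \<theta> r assms(1) by (simp add: fb Gamma0_eq_X_inner r_def)
  qed
  then have "AE t in lebesgue_on {0..}. 0 \<le> ?u t \<and> ?u t \<le> A * fst (y t)"
    by (intro AE_I2) simp
  then have adm: "admissible_pair A T x ?u y"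
    using assms(11) u_L2 by (simp add: admissible_pair_def)
  \<comment> \<open>Consumption under the feedback is \<theta> (A / r) times a functional that
    evolves exponentially, which is the candidate \<open>k\<close> at every time.\<close>
  have "A * fst (y t) - ?u t = k t" if "t \<ge> 0" for t
    using y.closed_loop_functional[OF assms(1) r root _ that, of \<theta>]
    unfolding k_def by (simp add: fb initial[OF assms(11)] C_def)
  then have value_y: "objective A \<rho> \<sigma> ?u y = ereal (v_explicit A T \<rho> \<sigma> x)"
    using discounted_utility_k[of "\<lambda>t. A * fst (y t) - ?u t"] by (simp add: v objective_def discounted_utility_def)
  have "value_function A T \<rho> \<sigma> x = ereal (v_explicit A T \<rho> \<sigma> x)"
    unfolding value_function_def
  proof (rule antisym)
    show "Sup {objective A \<rho> \<sigma> i z |i z. admissible_pair A T x i z} \<le> ereal (v_explicit A T \<rho> \<sigma> x)"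
      using upper by (auto intro!: Sup_least)
    show "ereal (v_explicit A T \<rho> \<sigma> x) \<le> Sup {objective A \<rho> \<sigma> i z |i z. admissible_pair A T x i z}"
      using adm value_y by (intro Sup_upper) (metis (mono_tags, lifting) mem_Collect_eq)
  qed
  then show ?thesis
    unfolding optimal_control_def using adm value_y by auto
qed

end
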